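(* Let $\nu,\alpha,\beta\in\mathbb{R}$ with $\alpha>-1-2\nu$ and $\beta>-1$. Let $f(z)=z^{\nu}F(z)$ belong to the class $\mathcal{A}$ (defined in the context), let $\lambda_n>0$, $n=1,2,\dots$, be the positive zeros of $F$, and suppose that $$\int_0^1 f(\lambda_n t)f(\lambda_m t)\,t^{\alpha}(1-t)^{\beta}\,dt=0\qquad\text{whenever } n\neq m .$$ Put $a=F''(0)$ and $\mu=2\nu+\alpha+1$. Then there is a constant $C$ such that $$f(z)=C\,z^{\nu}\sum_{n=0}^{\infty}a_{2n}z^{2n},$$ where $$a_{2n}=\left(\frac{a(\beta+1)}{2}\right)^n\prod_{j=1}^{n}\frac{(\beta+2(\mu+2j-1))\,(\mu)_{2(j-1)}}{(\mu+\beta+1)_{2j}-(\mu)_{2j}},\qquad n=0,1,\dots,$$ and the empty product equals $1$.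
   Context: Class $\mathcal{A}$: let $\nu,\alpha\in\mathbb{R}$ with $2\nu+\alpha>-1$. A function $f(z)=z^{\nu}F(z)$ is said to belong to the class $\mathcal{A}$ if $F$ is an even entire function with $F(0)=1$, of order less than two or of order two and minimal type, whose zeros are real and situated symmetrically about the origin, i.e. they are $\pm\lambda_n$ with $\lambda_n>0$, $n=1,2,\dots$, and $\sum_n\lambda_n^{-2}<\infty$. Here $z^{\nu}$ denotes a fixed branch of the power. Notation: $(b)_k=\Gamma(b+k)/\Gamma(b)$ is the Pochhammer symbol. *)

theory Defs
  imports "HOL-Complex_Analysis.Complex_Analysis"
begin

definition max_modulus :: "(complex \<Rightarrow> complex) \<Rightarrow> real \<Rightarrow> real" where
  "max_modulus F r = (SUP z\<in>sphere 0 r. norm (F z))"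

definition growth_order :: "(complex \<Rightarrow> complex) \<Rightarrow> ereal" where
  "growth_order F = Limsup at_top (\<lambda>r. ereal (ln (ln (max_modulus F r)) / ln r))"

text \<open>The type with respect to a given order \<open>\<rho>\<close>; minimal type means that it is zero.\<close>

definition growth_type :: "real \<Rightarrow> (complex \<Rightarrow> complex) \<Rightarrow> ereal" where
  "growth_type \<rho> F = Limsup at_top (\<lambda>r. ereal (ln (max_modulus F r) / r powr \<rho>))"

text \<open>
  A branch on \<open>D\<close> of the multivalued power with exponent \<open>\<nu>\<close>: a holomorphic selection of
  values \<open>exp (\<nu> * w)\<close> with \<open>w\<close> a logarithm of \<open>z\<close>. In particular \<open>0 \<notin> D\<close>. If \<open>\<nu>\<close> is an
  integer, then \<open>D\<close> may be the whole punctured plane.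
\<close>

definition power_branch :: "real \<Rightarrow> complex set \<Rightarrow> (complex \<Rightarrow> complex) \<Rightarrow> bool" where
  "power_branch \<nu> D p \<longleftrightarrow>
     open D \<and> connected D \<and> p holomorphic_on D \<and>
     (\<forall>z\<in>D. \<exists>w. exp w = z \<and> p z = exp (of_real \<nu> * w))"

text \<open>
  The function \<open>f\<close>, given on \<open>D\<close> by \<open>f z = p z * F z\<close> with \<open>p\<close> a branch of the power, belongs
  to the class \<open>\<A>\<close>, and \<open>l 0, l 1, \<dots>\<close> are the positive zeros of \<open>F\<close>, listed with
  multiplicity and in any order. The branch must be defined on the positive half-line, since
  \<open>f\<close> is evaluated at all points \<open>l n * t\<close> with \<open>0 < t < 1\<close>.
\<close>

definition class_A ::
  "real \<Rightarrow> real \<Rightarrow> complex set \<Rightarrow> (complex \<Rightarrow> complex) \<Rightarrow> (complex \<Rightarrow> complex) \<Rightarrow>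
   (nat \<Rightarrow> real) \<Rightarrow> (complex \<Rightarrow> complex) \<Rightarrow> bool" where
  "class_A \<nu> \<alpha> D p F l f \<longleftrightarrow>
     2 * \<nu> + \<alpha> > -1 \<and>
     power_branch \<nu> D p \<and> (\<forall>x>0. complex_of_real x \<in> D) \<and>
     (\<forall>z\<in>D. f z = p z * F z) \<and>
     F holomorphic_on UNIV \<and> (\<forall>z. F (- z) = F z) \<and> F 0 = 1 \<and>
     (growth_order F < 2 \<or> growth_order F = 2 \<and> growth_type 2 F = 0) \<and>
     (\<forall>n. l n > 0) \<and>
     (\<forall>z. F z = 0 \<longleftrightarrow> (\<exists>n. z = of_real (l n) \<or> z = - of_real (l n))) \<and>
     (\<forall>n. zorder F (of_real (l n)) = int (card {k. l k = l n})) \<and>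
     summable (\<lambda>n. 1 / (l n)\<^sup>2)"

text \<open>The coefficient of \<open>z ^ (2 * n)\<close>.\<close>

definition even_coeff :: "complex \<Rightarrow> real \<Rightarrow> real \<Rightarrow> nat \<Rightarrow> complex" where
  "even_coeff a \<beta> \<mu> n =
     (a * of_real (\<beta> + 1) / 2) ^ n *
     of_real (\<Prod>j=1..n.
       (\<beta> + 2 * (\<mu> + 2 * real j - 1)) * pochhammer \<mu> (2 * (j - 1)) /
       (pochhammer (\<mu> + \<beta> + 1) (2 * j) - pochhammer \<mu> (2 * j)))"

end

theory Submission
  imports Defs "HOL-Real_Asymp.Real_Asymp"
begin

text \<open>
  Since \<open>F\<close> is even, \<open>F z = \<Phi> (z^2)\<close> with \<open>\<Phi>\<close> entire. The growth condition makes \<open>\<Phi>\<close> a function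
  of minimal exponential type, and its zeros \<open>s n = (l n)^2\<close> are positive. On the positive
  half-line the branch of the power is a constant multiple of \<open>x powr \<nu>\<close>, so that the
  orthogonality relations become \<open>\<integral> \<Phi> (t^2 s n) \<Phi> (t^2 s m) dM(t) = 0\<close> for \<open>n \<noteq> m\<close>, where \<open>M\<close> has
  density \<open>t powr (\<mu> - 1) * (1 - t) powr \<beta>\<close> on the unit interval. The case \<open>s n = s m\<close> of this
  relation is impossible, because \<open>\<Phi>\<close> is real on the real line; hence all zeros are simple.

  The proof works with the transforms \<open>T \<phi> w = \<integral> \<Phi> (t^2 w) \<phi> t dM(t)\<close> and rests on one fact:
  if \<open>K w = T \<phi> w + w * T \<psi> w\<close> vanishes at every \<open>s k\<close>, then \<open>K = K 0 * \<Phi>\<close>. To see this, let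
  \<open>h = K / \<Phi>\<close>, an entire function. By Hadamard, \<open>\<Phi> w\<close> is the product of the factors
  \<open>1 - w / s k\<close>, and each factor grows in modulus along the rays of the left half-plane.
  Hence \<open>norm (\<Phi> (t^2 w)) \<le> norm (\<Phi> w)\<close> there, which bounds \<open>h w\<close> by a multiple of \<open>1 + norm w\<close>
  on the left half-plane. The quotient \<open>h\<close> again has minimal type, so the theorem of
  Phragmen and Lindelof extends this bound to the right half-plane (a half-plane is exactly
  the domain for which minimal exponential type suffices), and \<open>h\<close> is a polynomial of degree at
  most one. Along the negative axis \<open>T \<psi> / \<Phi>\<close> tends to zero, because \<open>\<Phi>\<close> has infinitely many
  zeros, and so the linear coefficient of \<open>h\<close> vanishes.

  This fact is used twice; \<open>c k\<close> denotes the Taylor coefficients of \<open>\<Phi>\<close>. First take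
  \<open>\<phi> t = \<Phi> (t^2 s n)\<close> and \<open>\<psi> = - \<phi> / s n\<close>: then \<open>K w = (1 - w / s n) * T \<phi> w\<close> vanishes at every
  zero by orthogonality, and the coefficient of \<open>w\<close> in \<open>K = K 0 * \<Phi>\<close> gives
  \<open>s n * c 1 * \<integral> (t^2 - 1) \<Phi> (t^2 s n) dM(t) = \<integral> \<Phi> (t^2 s n) dM(t)\<close>. This equation no longer
  involves two zeros: it says that the choice \<open>\<phi> t = - 1\<close>, \<open>\<psi> t = c 1 * (t^2 - 1)\<close> also
  satisfies the hypothesis. The second application, compared at all powers of \<open>w\<close>, is the recurrence
  \<open>c (k + 1) * (m 0 - m (k + 1)) = c 1 * c k * (m k - m (k + 1))\<close> with the moments
  \<open>m k = \<integral> t^(2k) dM(t)\<close>. Here \<open>m k\<close> is the value \<open>Beta (\<mu> + 2 k) (\<beta> + 1)\<close>, which turns the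
  recurrence into the product formula; the constant \<open>C\<close> is \<open>1\<close>.
\<close>

section \<open>Power series, division by zeros, and even entire functions\<close>

lemma entire_power_series:
  assumes "\<And>w. (\<lambda>k. a k * w ^ k) sums f w"
  shows "f holomorphic_on (UNIV :: complex set)"
proof -
  have "f field_differentiable at w" for w
  proof -
    have "f holomorphic_on ball 0 (norm w + 1)"
      using assms by (intro power_series_holomorphic[where a = a]) simp
    then show ?thesis
      by (rule holomorphic_on_imp_differentiable_at) auto
  qed
  then show ?thesis by (simp add: holomorphic_on_def)
qed

lemma power_series_coeff_unique:
  assumes "\<And>w::complex. (\<lambda>k. a k * w ^ k) sums f w" "\<And>w. (\<lambda>k. b k * w ^ k) sums f w"
  shows "a = b"
proof -
  have "f has_fps_expansion Abs_fps a" "f has_fps_expansion Abs_fps b"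
    using assms by (auto intro!: has_fps_expansionI always_eventually)
  then have "Abs_fps a = Abs_fps b" by (rule fps_expansion_unique_complex)
  then show ?thesis by (metis fps_nth_Abs_fps ext)
qed

text \<open>
  The factor is normalised to \<open>1 - w / b\<close>, as in a canonical product, so that it does not affect
  the value at the origin.
\<close>
lemma divide_out_zero:
  assumes "h holomorphic_on UNIV" "h 0 \<noteq> 0" "b \<noteq> 0"
  obtains g where "g holomorphic_on UNIV" "g b \<noteq> 0"
    "\<And>w. h w = (1 - w / b) ^ nat (zorder h b) * g w"
proof -
  define n where "n = nat (zorder h b)"
  obtain r q where r: "r > 0" "q holomorphic_on cball b r"
      "\<And>w. w \<in> cball b r \<Longrightarrow> h w = q w * (w - b) ^ n \<and> q w \<noteq> 0"
    using zorder_exist_zero[of h UNIV b] assms unfolding n_def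
    by (metis UNIV_I connected_UNIV open_UNIV)
  define g where "g w = (- b) ^ n * (if w \<in> ball b r then q w else h w / (w - b) ^ n)" for w
  have split: "(w - b) ^ n = (1 - w / b) ^ n * (- b) ^ n" for w
    using \<open>b \<noteq> 0\<close> by (simp add: field_simps flip: power_mult_distrib)
  have eq: "h w = (1 - w / b) ^ n * g w" for w
  proof (cases "w \<in> ball b r")
    case True
    then show ?thesis using r(3)[of w] split[of w] by (simp add: g_def)
  next
    case False
    then have "w \<noteq> b" using r by auto
    then have "(w - b) ^ n \<noteq> 0" by simp
    then have "h w = (w - b) ^ n * (h w / (w - b) ^ n)" by simp
    also have "\<dots> = (1 - w / b) ^ n * ((- b) ^ n * (h w / (w - b) ^ n))"
      by (subst (1) split) (simp only: mult.assoc)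
    also have "\<dots> = (1 - w / b) ^ n * g w" using False by (simp add: g_def)
    finally show ?thesis .
  qed
  have g2: "g w = (- b) ^ n * (h w / (w - b) ^ n)" if "w \<noteq> b" for w
    using that r(3)[of w] by (auto simp: g_def)
  have "g holomorphic_on (ball b r \<union> - {b})"
  proof (rule holomorphic_on_Un)
    have "(\<lambda>w. (- b) ^ n * q w) holomorphic_on ball b r"
      using r(2) by (intro holomorphic_intros) (auto elim: holomorphic_on_subset)
    then show "g holomorphic_on ball b r"
      by (rule holomorphic_transform) (simp add: g_def)
    have "(\<lambda>w. (- b) ^ n * (h w / (w - b) ^ n)) holomorphic_on - {b}"
      using assms(1) by (intro holomorphic_intros) (auto elim: holomorphic_on_subset)
    then show "g holomorphic_on - {b}"
      by (rule holomorphic_transform) (simp add: g2)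
  qed auto
  moreover have "ball b r \<union> - {b} = UNIV" using r by auto
  moreover have "g b \<noteq> 0" using r(1) r(3)[of b] \<open>b \<noteq> 0\<close> by (simp add: g_def)
  ultimately show thesis using that eq unfolding n_def by metis
qed

lemma divide_out_zeros:
  assumes f: "f holomorphic_on UNIV" "f 0 \<noteq> 0" and A: "finite A" "0 \<notin> A"
  shows "\<exists>h. h holomorphic_on UNIV \<and> (\<forall>a\<in>A. h a \<noteq> 0) \<and>
    (\<forall>w. f w = (\<Prod>a\<in>A. (1 - w / a) ^ nat (zorder f a)) * h w)"
  using A
proof (induction A rule: finite_induct)
  case empty
  then show ?case using f by (intro exI[of _ f]) auto
next
  case (insert b A)
  define P where "P w = (\<Prod>a\<in>A. (1 - w / a) ^ nat (zorder f a))" for w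
  obtain h where h: "h holomorphic_on UNIV" "\<And>a. a \<in> A \<Longrightarrow> h a \<noteq> 0" "\<And>w. f w = P w * h w"
    using insert unfolding P_def by blast
  have "h 0 \<noteq> 0" using h(3)[of 0] f(2) by auto
  moreover have "b \<noteq> 0" using insert by auto
  ultimately obtain g where g: "g holomorphic_on UNIV" "g b \<noteq> 0"
      "\<And>w. h w = (1 - w / b) ^ nat (zorder h b) * g w"
    using divide_out_zero[OF h(1)] by metis
  have P: "P holomorphic_on UNIV" unfolding P_def
    using insert.prems by (intro holomorphic_intros) auto
  have "P b \<noteq> 0" unfolding P_def using insert by (auto simp: field_simps)
  define n where "n = nat (zorder h b)"
  have "zorder f b = int n"
  proof (rule zorder_eqI[where S = UNIV])
    show "(\<lambda>w. P w * (g w / (- b) ^ n)) holomorphic_on UNIV"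
      using P g \<open>b \<noteq> 0\<close> by (intro holomorphic_intros) auto
    show "f w = P w * (g w / (- b) ^ n) * (w - b) powi int n" for w
    proof -
      have "1 - w / b = (w - b) / (- b)" using \<open>b \<noteq> 0\<close> by (simp add: field_simps)
      then have "(1 - w / b) ^ n = (w - b) ^ n / (- b) ^ n" by (simp only: power_divide)
      then show ?thesis using h(3)[of w] g(3)[of w, folded n_def] by simp
    qed
  qed (use \<open>P b \<noteq> 0\<close> g \<open>b \<noteq> 0\<close> in auto)
  then have n: "nat (zorder f b) = n" by simp
  show ?case
  proof (intro exI[of _ g] conjI ballI allI)
    show "g holomorphic_on UNIV" by fact
    show "g a \<noteq> 0" if "a \<in> insert b A" for a
      using that g(2) g(3)[of a] h(2)[of a] by auto
    show "f w = (\<Prod>a\<in>insert b A. (1 - w / a) ^ nat (zorder f a)) * g w" for w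
      using insert.hyps h(3)[of w] g(3)[of w] n unfolding P_def n_def by (simp add: mult_ac)
  qed
qed

text \<open>
  At a common zero \<open>a\<close> both functions are replaced by their difference quotients, which are
  holomorphic and, for the denominator, nonzero near \<open>a\<close>.
\<close>
lemma entire_quotient:
  assumes K: "K holomorphic_on UNIV" and f: "f holomorphic_on UNIV"
    and simple: "\<And>z. f z = 0 \<Longrightarrow> K z = 0 \<and> deriv f z \<noteq> 0"
  obtains h where "h holomorphic_on UNIV" "\<And>z. K z = h z * f z"
proof -
  define h where "h z = (if f z = 0 then deriv K z / deriv f z else K z / f z)" for z
  have "\<exists>h'. (h has_field_derivative h') (at a)" for a
  proof -
    define slope where "slope g z = (if z = a then deriv g a else (g z - g a) / (z - a))"
      for g :: "complex \<Rightarrow> complex" and z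
    have slope: "slope g holomorphic_on UNIV" if "g holomorphic_on UNIV" for g
      unfolding slope_def[abs_def] by (rule pole_lemma_open) (use that in auto)
    define q where "q = (if f a = 0 then (\<lambda>z. slope K z / slope f z) else (\<lambda>z. K z / f z))"
    define D where "D = (if f a = 0 then slope f else f)"
    have D: "D holomorphic_on UNIV" "D a \<noteq> 0"
      using f slope simple[of a] by (auto simp: D_def) (auto simp: slope_def)
    have "open (D -` (- {0}))"
      using D(1) by (intro open_vimage) (auto intro: holomorphic_on_imp_continuous_on)
    moreover have "a \<in> D -` (- {0})" using D by auto
    ultimately obtain r where r: "r > 0" "ball a r \<subseteq> D -` (- {0})"
      unfolding open_contains_ball by blast
    have "q holomorphic_on ball a r"
    proof (cases "f a = 0")
      case True
      then have *: "\<And>z. z \<in> ball a r \<Longrightarrow> slope f z \<noteq> 0" using r by (auto simp: D_def)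
      have "(\<lambda>z. slope K z / slope f z) holomorphic_on ball a r"
        by (intro holomorphic_on_divide * holomorphic_on_subset[OF slope] K f) auto
      then show ?thesis using True by (simp add: q_def)
    next
      case False
      then have *: "\<And>z. z \<in> ball a r \<Longrightarrow> f z \<noteq> 0" using r by (auto simp: D_def)
      have "(\<lambda>z. K z / f z) holomorphic_on ball a r"
        by (intro holomorphic_on_divide * holomorphic_on_subset[OF K] holomorphic_on_subset[OF f]) auto
      then show ?thesis using False by (simp add: q_def)
    qed
    moreover have "h z = q z" if "z \<in> ball a r" for z
    proof (cases "f a = 0")
      case True
      have "D z \<noteq> 0" using that r by auto
      then have "slope f z \<noteq> 0" using True by (auto simp: D_def)
      then show ?thesis using True simple[of a]
        by (auto simp: h_def q_def slope_def)
    next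
      case False
      have "D z \<noteq> 0" using that r by auto
      then show ?thesis using False by (auto simp: h_def q_def D_def)
    qed
    ultimately have "h holomorphic_on ball a r"
      by (metis holomorphic_transform)
    then show ?thesis using r
      by (metis centre_in_ball holomorphic_derivI open_ball)
  qed
  then have "h holomorphic_on UNIV"
    by (simp add: holomorphic_on_open)
  moreover have "K z = h z * f z" for z
    using simple[of z] by (auto simp: h_def)
  ultimately show thesis using that by blast
qed

text \<open>
  The odd Taylor coefficients vanish, so the even ones form an everywhere convergent series in
  \<open>z\<^sup>2\<close>. Evenness also makes \<open>F (csqrt w)\<close> independent of the choice of the root.
\<close>
lemma even_entire_obtains:
  assumes F: "F holomorphic_on UNIV" and even: "\<And>z. F (- z) = F z"
  obtains \<Phi> where "\<Phi> holomorphic_on UNIV" "\<And>z. F z = \<Phi> (z\<^sup>2)"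
proof -
  define a where "a k = (deriv ^^ k) F 0 / fact k" for k
  have sums: "(\<lambda>k. a k * z ^ k) sums F z" for z
    using holomorphic_power_series[of F 0 "norm z + 1" z] F
    by (simp add: a_def holomorphic_on_subset)
  have "(\<lambda>k. ((- 1) ^ k * a k) * z ^ k) sums F z" for z
  proof -
    have "a k * (- z) ^ k = ((- 1) ^ k * a k) * z ^ k" for k
      by (subst power_minus) simp
    then show ?thesis using sums[of "- z"] even[of z] by (simp only:)
  qed
  then have "(\<lambda>k. (- 1) ^ k * a k) = a" using sums by (rule power_series_coeff_unique)
  then have sign: "(- 1) ^ k * a k = a k" for k by (rule fun_cong)
  have odd: "a k = 0" if "odd k" for k
    using sign[of k] that by (simp add: complex_eq_iff)
  have even_sums: "(\<lambda>k. a (2 * k) * (z\<^sup>2) ^ k) sums F z" for z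
  proof -
    have "(\<lambda>k. a (2 * k) * z ^ (2 * k)) sums F z"
      using sums[of z] sums_mono_reindex[of "(*) 2" "\<lambda>k. a k * z ^ k" "F z"] odd
      by (auto simp: strict_mono_def elim!: evenE)
    then show ?thesis by (simp add: power_mult)
  qed
  define \<Phi> where "\<Phi> w = F (csqrt w)" for w
  have "(\<lambda>k. a (2 * k) * w ^ k) sums \<Phi> w" for w
    using even_sums[of "csqrt w"] by (simp add: \<Phi>_def)
  then have "\<Phi> holomorphic_on UNIV" by (rule entire_power_series)
  moreover have "F z = \<Phi> (z\<^sup>2)" for z
  proof -
    have "csqrt (z\<^sup>2) = z \<or> csqrt (z\<^sup>2) = - z" by (metis power2_csqrt power2_eq_iff)
    then show ?thesis using even by (auto simp: \<Phi>_def)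
  qed
  ultimately show thesis using that by blast
qed

text \<open>
  Away from the origin squaring is locally invertible and preserves multiplicities; this carries
  the multiplicities of the zeros of \<open>F\<close> over to \<open>\<Phi>\<close>.
\<close>
lemma zorder_square_argument:
  assumes \<Phi>: "\<Phi> holomorphic_on UNIV" "\<Phi> 0 \<noteq> 0" and "b \<noteq> 0"
  shows "zorder (\<lambda>z. \<Phi> (z\<^sup>2)) b = zorder \<Phi> (b\<^sup>2)"
proof -
  define n where "n = nat (zorder \<Phi> (b\<^sup>2))"
  have "zorder \<Phi> (b\<^sup>2) \<ge> 0"
  proof -
    have "\<exists>w\<in>UNIV. \<Phi> w \<noteq> 0" using \<Phi>(2) by blast
    then show ?thesis
      using zorder_exist_zero[OF \<Phi>(1) open_UNIV connected_UNIV, of "b\<^sup>2"]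
      by (auto split: if_splits)
  qed
  then have n: "zorder \<Phi> (b\<^sup>2) = int n" by (simp add: n_def)
  obtain g where g: "g holomorphic_on UNIV" "g (b\<^sup>2) \<noteq> 0"
    "\<And>w. \<Phi> w = (1 - w / b\<^sup>2) ^ n * g w"
    using divide_out_zero[OF \<Phi>, of "b\<^sup>2"] \<open>b \<noteq> 0\<close> unfolding n_def by auto
  define q where "q z = (- (z + b) / b\<^sup>2) ^ n * g (z\<^sup>2)" for z
  have "zorder (\<lambda>z. \<Phi> (z\<^sup>2)) b = int n"
  proof (rule zorder_eqI[where S = UNIV and g = q])
    have "(g \<circ> (\<lambda>z. z\<^sup>2)) holomorphic_on UNIV"
      by (rule holomorphic_on_compose_gen[OF _ g(1)]) (auto intro!: holomorphic_intros)
    then show "q holomorphic_on UNIV"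
      unfolding q_def o_def using \<open>b \<noteq> 0\<close> by (intro holomorphic_intros) auto
    show "q b \<noteq> 0" using g(2) \<open>b \<noteq> 0\<close> by (simp add: q_def flip: mult_2)
    fix z
    have factor: "1 - z\<^sup>2 / b\<^sup>2 = (- (z + b) / b\<^sup>2) * (z - b)"
      using \<open>b \<noteq> 0\<close> by (simp add: field_simps power2_eq_square)
    show "\<Phi> (z\<^sup>2) = q z * (z - b) powi int n"
      unfolding g(3) q_def factor power_mult_distrib by simp
  qed auto
  then show ?thesis using n by simp
qed

lemma deriv_deriv_square_argument:
  assumes "\<Phi> holomorphic_on UNIV"
  shows "deriv (deriv (\<lambda>z. \<Phi> (z\<^sup>2))) 0 = 2 * deriv \<Phi> 0"
proof -
  have d\<Phi>: "(\<Phi> has_field_derivative deriv \<Phi> w) (at w)" for w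
    using assms by (simp add: holomorphic_derivI)
  have "((\<lambda>z. \<Phi> (z\<^sup>2)) has_field_derivative deriv \<Phi> (z\<^sup>2) * (2 * z)) (at z)" for z
    by (rule DERIV_chain2[OF d\<Phi>]) (auto intro!: derivative_eq_intros)
  then have 1: "deriv (\<lambda>z. \<Phi> (z\<^sup>2)) = (\<lambda>z. deriv \<Phi> (z\<^sup>2) * (2 * z))"
    by (intro ext DERIV_imp_deriv)
  have "deriv \<Phi> holomorphic_on UNIV" using assms by (intro holomorphic_deriv) auto
  then have "(deriv \<Phi> has_field_derivative deriv (deriv \<Phi>) w) (at w)" for w
    by (simp add: holomorphic_derivI)
  then have "((\<lambda>z. deriv \<Phi> (z\<^sup>2)) has_field_derivative deriv (deriv \<Phi>) (0\<^sup>2) * (2 * 0)) (at 0)"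
    by (rule DERIV_chain2) (auto intro!: derivative_eq_intros)
  then have "((\<lambda>z. deriv \<Phi> (z\<^sup>2) * (2 * z)) has_field_derivative 2 * deriv \<Phi> 0) (at 0)"
    by (auto intro!: derivative_eq_intros)
  then show ?thesis unfolding 1 by (rule DERIV_imp_deriv)
qed

section \<open>Functions of minimal exponential type\<close>

text \<open>
  Order less than one, or order one and minimal type. The form with a constant \<open>C\<close>, instead of a
  bound outside a disc, is closed under sums and products and can be integrated.
\<close>
definition minimal_type :: "(complex \<Rightarrow> complex) \<Rightarrow> bool" where
  "minimal_type f \<longleftrightarrow> (\<forall>\<epsilon>>0. \<exists>C. \<forall>w. norm (f w) \<le> C * exp (\<epsilon> * norm w))"

lemma minimal_typeE:
  assumes "minimal_type f" "\<epsilon> > 0"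
  obtains C where "C > 0" "\<And>w. norm (f w) \<le> C * exp (\<epsilon> * norm w)"
proof -
  obtain C where C: "\<And>w. norm (f w) \<le> C * exp (\<epsilon> * norm w)"
    using assms unfolding minimal_type_def by blast
  have "norm (f w) \<le> max C 1 * exp (\<epsilon> * norm w)" for w
    by (rule order_trans[OF C]) (intro mult_right_mono, auto)
  then show thesis by (intro that[of "max C 1"]) auto
qed

lemma minimal_type_add:
  assumes "minimal_type f" "minimal_type g"
  shows "minimal_type (\<lambda>w. f w + g w)"
  unfolding minimal_type_def
proof (intro allI impI)
  fix \<epsilon> :: real assume "\<epsilon> > 0"
  obtain C where C: "C > 0" "\<And>w. norm (f w) \<le> C * exp (\<epsilon> * norm w)"
    using minimal_typeE[OF assms(1) \<open>\<epsilon> > 0\<close>] by blast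
  obtain C' where C': "C' > 0" "\<And>w. norm (g w) \<le> C' * exp (\<epsilon> * norm w)"
    using minimal_typeE[OF assms(2) \<open>\<epsilon> > 0\<close>] by blast
  show "\<exists>C. \<forall>w. norm (f w + g w) \<le> C * exp (\<epsilon> * norm w)"
  proof (intro exI[of _ "C + C'"] allI)
    fix w
    show "norm (f w + g w) \<le> (C + C') * exp (\<epsilon> * norm w)"
      using norm_triangle_ineq[of "f w" "g w"] C(2)[of w] C'(2)[of w]
      by (simp add: distrib_right)
  qed
qed

lemma minimal_type_times_id:
  assumes "minimal_type f"
  shows "minimal_type (\<lambda>w. w * f w)"
  unfolding minimal_type_def
proof (intro allI impI)
  fix \<epsilon> :: real assume "\<epsilon> > 0"
  then obtain C where C: "C > 0" "\<And>w. norm (f w) \<le> C * exp (\<epsilon>/2 * norm w)"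
    using minimal_typeE[OF assms, of "\<epsilon>/2"] by auto
  show "\<exists>C. \<forall>w. norm (w * f w) \<le> C * exp (\<epsilon> * norm w)"
  proof (intro exI[of _ "2/\<epsilon> * C"] allI)
    fix w :: complex
    have "\<epsilon>/2 * norm w \<le> exp (\<epsilon>/2 * norm w)"
      using exp_ge_add_one_self[of "\<epsilon>/2 * norm w"] by linarith
    then have "norm w \<le> 2/\<epsilon> * exp (\<epsilon>/2 * norm w)"
      using \<open>\<epsilon> > 0\<close> by (simp add: field_simps)
    then have "norm w * norm (f w) \<le> (2/\<epsilon> * exp (\<epsilon>/2 * norm w)) * (C * exp (\<epsilon>/2 * norm w))"
      using C \<open>\<epsilon> > 0\<close> by (intro mult_mono) auto
    also have "\<dots> = 2/\<epsilon> * C * (exp (\<epsilon>/2 * norm w) * exp (\<epsilon>/2 * norm w))" by simp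
    also have "exp (\<epsilon>/2 * norm w) * exp (\<epsilon>/2 * norm w) = exp (\<epsilon> * norm w)"
      by (simp flip: exp_add)
    finally show "norm (w * f w) \<le> 2/\<epsilon> * C * exp (\<epsilon> * norm w)" by (simp add: norm_mult)
  qed
qed

lemma max_modulus_ge:
  assumes "continuous_on UNIV F"
  shows "norm (F z) \<le> max_modulus F (norm z)"
  unfolding max_modulus_def
proof (rule cSUP_upper)
  have "compact ((\<lambda>z. norm (F z)) ` sphere 0 (norm z))"
    by (intro compact_continuous_image continuous_on_norm continuous_on_subset[OF assms]) auto
  then show "bdd_above ((\<lambda>z. norm (F z)) ` sphere 0 (norm z))"
    by (intro bounded_imp_bdd_above compact_imp_bounded)
qed simp

lemma max_modulus_ge_1:
  assumes F: "F holomorphic_on UNIV" "F 0 = 1" and "r > 0"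
  shows "max_modulus F r \<ge> 1"
proof -
  have cont: "continuous_on UNIV F" using F(1) by (rule holomorphic_on_imp_continuous_on)
  have "norm (F 0) \<le> max_modulus F r"
  proof (rule maximum_modulus_frontier[of F "cball 0 r"])
    fix z :: complex assume "z \<in> frontier (cball 0 r)"
    then have "norm z = r" using \<open>r > 0\<close> by (simp add: frontier_cball)
    then show "norm (F z) \<le> max_modulus F r" using max_modulus_ge[OF cont, of z] by simp
  qed (use F cont \<open>r > 0\<close> in \<open>auto intro: holomorphic_on_subset continuous_on_subset\<close>)
  then show ?thesis using F(2) by simp
qed

lemma ln_max_modulus_le:
  assumes F: "F holomorphic_on UNIV" "F 0 = 1"
    and order: "growth_order F < 2 \<or> growth_order F = 2 \<and> growth_type 2 F = 0"
    and "\<epsilon> > 0"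
  shows "eventually (\<lambda>r. ln (max_modulus F r) \<le> \<epsilon> * r\<^sup>2) at_top"
  using order
proof
  assume "growth_order F < 2"
  then obtain \<rho> where \<rho>: "growth_order F < ereal \<rho>" "ereal \<rho> < 2"
    using ereal_dense2 by blast
  have "\<rho> < 2" using \<rho>(2) by (metis ereal_less(2) less_ereal.simps(1) numeral_eq_ereal)
  have "eventually (\<lambda>r. ereal (ln (ln (max_modulus F r)) / ln r) < ereal \<rho>) at_top"
    using \<rho>(1) unfolding growth_order_def by (rule Limsup_lessD)
  moreover have "eventually (\<lambda>r. r powr \<rho> \<le> \<epsilon> * r\<^sup>2) at_top"
    using \<open>\<rho> < 2\<close> \<open>\<epsilon> > 0\<close> by real_asymp
  ultimately show ?thesis using eventually_gt_at_top[of 1]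
  proof eventually_elim
    case (elim r)
    show ?case
    proof (cases "ln (max_modulus F r) > 0")
      case True
      have "ln r > 0" using elim by simp
      then have "ln (ln (max_modulus F r)) < \<rho> * ln r" using elim by (simp add: divide_less_eq)
      then have "ln (max_modulus F r) < exp (\<rho> * ln r)"
        using True by (metis exp_less_cancel_iff exp_ln)
      also have "\<dots> = r powr \<rho>" using elim by (simp add: powr_def)
      finally show ?thesis using elim by linarith
    next
      case False
      then show ?thesis using \<open>\<epsilon> > 0\<close>
        by (meson mult_nonneg_nonneg less_imp_le not_le order_trans zero_le_power2)
    qed
  qed
next
  assume "growth_order F = 2 \<and> growth_type 2 F = 0"
  then have "growth_type 2 F < ereal \<epsilon>" using \<open>\<epsilon> > 0\<close> by (simp add: zero_ereal_def)
  then have "eventually (\<lambda>r. ereal (ln (max_modulus F r) / r powr 2) < ereal \<epsilon>) at_top"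
    unfolding growth_type_def by (rule Limsup_lessD)
  then show ?thesis using eventually_gt_at_top[of 0]
  proof eventually_elim
    case (elim r)
    then show ?case by (simp add: divide_less_eq powr_numeral)
  qed
qed

lemma minimal_type_of_order_2:
  assumes F: "F holomorphic_on UNIV" "F 0 = 1"
    and order: "growth_order F < 2 \<or> growth_order F = 2 \<and> growth_type 2 F = 0"
    and \<Phi>: "\<And>z. F z = \<Phi> (z\<^sup>2)"
  shows "minimal_type \<Phi>"
  unfolding minimal_type_def
proof (intro allI impI)
  fix \<epsilon> :: real assume "\<epsilon> > 0"
  have cont: "continuous_on UNIV F" using F(1) by (rule holomorphic_on_imp_continuous_on)
  obtain r0 where r0: "\<And>r. r \<ge> r0 \<Longrightarrow> ln (max_modulus F r) \<le> \<epsilon> * r\<^sup>2"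
    using ln_max_modulus_le[OF F order \<open>\<epsilon> > 0\<close>] unfolding eventually_at_top_linorder by blast
  define r1 where "r1 = max r0 1"
  have "compact (F ` cball 0 r1)"
    by (intro compact_continuous_image continuous_on_subset[OF cont]) auto
  then obtain B where B: "\<And>z. norm z \<le> r1 \<Longrightarrow> norm (F z) \<le> B"
    by (metis bounded_iff compact_imp_bounded imageI mem_cball_0)
  show "\<exists>C. \<forall>w. norm (\<Phi> w) \<le> C * exp (\<epsilon> * norm w)"
  proof (intro exI[of _ "max B 1"] allI)
    fix w
    define z where "z = csqrt w"
    have w: "w = z\<^sup>2" by (simp add: z_def)
    have "exp (\<epsilon> * (norm z)\<^sup>2) \<ge> 1" using \<open>\<epsilon> > 0\<close> by simp
    have "norm (F z) \<le> max B 1 * exp (\<epsilon> * (norm z)\<^sup>2)"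
    proof (cases "norm z \<le> r1")
      case True
      then have "norm (F z) \<le> max B 1 * 1" using B by (simp add: le_max_iff_disj)
      also have "\<dots> \<le> max B 1 * exp (\<epsilon> * (norm z)\<^sup>2)"
        using \<open>exp (\<epsilon> * (norm z)\<^sup>2) \<ge> 1\<close> by (intro mult_left_mono) auto
      finally show ?thesis .
    next
      case False
      then have "norm z \<ge> r0" "norm z > 0" by (auto simp: r1_def)
      have "norm (F z) \<le> max_modulus F (norm z)" by (rule max_modulus_ge[OF cont])
      also have "\<dots> \<le> exp (\<epsilon> * (norm z)\<^sup>2)"
        using r0[OF \<open>norm z \<ge> r0\<close>] max_modulus_ge_1[OF F \<open>norm z > 0\<close>]
        by (subst ln_le_cancel_iff[symmetric]) auto
      also have "\<dots> \<le> max B 1 * exp (\<epsilon> * (norm z)\<^sup>2)"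
        by (simp add: mult_le_cancel_right1)
      finally show ?thesis .
    qed
    then show "norm (\<Phi> w) \<le> max B 1 * exp (\<epsilon> * norm w)"
      using \<Phi>[of z] by (simp add: w norm_power)
  qed
qed

section \<open>The Borel-Caratheodory and Phragmen-Lindelof inequalities\<close>

text \<open>
  The map \<open>v \<mapsto> v / (2 A - v)\<close> sends the half-plane \<open>Re v < A\<close> into the unit disc and fixes the
  origin, so the Schwarz lemma applies to its composition with \<open>g\<close>.
\<close>
lemma borel_caratheodory:
  assumes g: "g holomorphic_on ball 0 \<rho>" "g 0 = 0" and "\<rho> > 0" "A > 0"
    and Re: "\<And>w. norm w < \<rho> \<Longrightarrow> Re (g w) < A" and w: "norm w < \<rho>"
  shows "norm (g w) * (\<rho> - norm w) \<le> 2 * A * norm w"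
proof -
  have less: "norm (g v) < norm (2 * of_real A - g v)" if "norm v < \<rho>" for v
  proof (rule power2_less_imp_less)
    have "(norm (2 * of_real A - g v))\<^sup>2 - (norm (g v))\<^sup>2 = 4 * A * (A - Re (g v))"
      unfolding cmod_power2 by (simp add: power2_eq_square algebra_simps)
    also have "\<dots> > 0" using Re[OF that] \<open>A > 0\<close> by simp
    finally show "(norm (g v))\<^sup>2 < (norm (2 * of_real A - g v))\<^sup>2" by simp
  qed simp
  define \<phi> where "\<phi> u = g (of_real \<rho> * u) / (2 * of_real A - g (of_real \<rho> * u))" for u
  have ball: "norm (of_real \<rho> * u) < \<rho>" if "norm u < 1" for u :: complex
    using that \<open>\<rho> > 0\<close> by (simp add: norm_mult)
  have nz: "2 * of_real A - g v \<noteq> 0" if "norm v < \<rho>" for v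
    using less[OF that] by auto
  have "\<phi> holomorphic_on ball 0 1"
    unfolding \<phi>_def
  proof (intro holomorphic_intros)
    have *: "(g \<circ> (\<lambda>u. of_real \<rho> * u)) holomorphic_on ball 0 1"
      by (rule holomorphic_on_compose_gen[OF _ g(1)]) (use ball in \<open>auto intro!: holomorphic_intros\<close>)
    then show "(\<lambda>u. g (of_real \<rho> * u)) holomorphic_on ball 0 1" by (simp add: o_def)
    then show "(\<lambda>u. g (of_real \<rho> * u)) holomorphic_on ball 0 1" .
    show "2 * of_real A - g (of_real \<rho> * u) \<noteq> 0" if "u \<in> ball 0 1" for u
      using that by (intro nz ball) auto
  qed
  moreover have "\<phi> 0 = 0" using g by (simp add: \<phi>_def)
  moreover have "norm (\<phi> u) < 1" if "norm u < 1" for u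
    using less[OF ball[OF that]] nz[OF ball[OF that]] by (simp add: \<phi>_def norm_divide)
  moreover have "norm (w / of_real \<rho>) < 1" using w \<open>\<rho> > 0\<close> by (simp add: norm_divide)
  ultimately have "norm (\<phi> (w / of_real \<rho>)) \<le> norm (w / of_real \<rho>)"
    by (rule Schwarz_Lemma(1))
  then have "norm (g w) / norm (2 * of_real A - g w) \<le> norm w / \<rho>"
    using \<open>\<rho> > 0\<close> by (simp add: \<phi>_def norm_divide)
  then have "norm (g w) * \<rho> \<le> norm w * norm (2 * of_real A - g w)"
    using \<open>\<rho> > 0\<close> nz[OF w] by (simp add: field_simps)
  also have "\<dots> \<le> norm w * (2 * A + norm (g w))"
    using norm_triangle_ineq4[of "2 * of_real A" "g w"] \<open>A > 0\<close>
    by (intro mult_left_mono) (simp_all add: norm_mult)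
  finally show ?thesis by (simp add: algebra_simps)
qed

text \<open>
  Apply the maximum principle on the half-disc of radius \<open>R\<close> to \<open>f * e\<close>, where \<open>e\<close> is built from
  \<open>V v = R\<^sup>2 v / (v\<^sup>2 + R\<^sup>2)\<close>. This rational function has real part zero on the imaginary axis and at
  least \<open>R / 2\<close> on the arc, so \<open>exp (- 4 \<epsilon> V)\<close> compensates the growth of \<open>f\<close> on the arc without
  disturbing the axis. At a fixed point \<open>V\<close> tends to \<open>v\<close> as \<open>R\<close> grows, so that only
  \<open>exp (4 \<epsilon> Re w)\<close> is lost in the limit. The poles of \<open>V\<close> sit at the two corners of the half-disc, and the extra
  factor \<open>(v\<^sup>2 + R\<^sup>2) / R\<^sup>2\<close>, which causes the constant \<open>2\<close>, restores continuity there.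
\<close>
lemma phragmen_lindelof_half_plane:
  assumes f: "f holomorphic_on {w. Re w > 0}" "continuous_on {w. Re w \<ge> 0} f"
    and growth: "\<And>\<epsilon>. \<epsilon> > 0 \<Longrightarrow> \<exists>C. \<forall>w. Re w \<ge> 0 \<longrightarrow> norm (f w) \<le> C * exp (\<epsilon> * norm w)"
    and axis: "\<And>w. Re w = 0 \<Longrightarrow> norm (f w) \<le> M"
    and "Re w \<ge> 0"
  shows "norm (f w) \<le> 2 * M"
proof -
  have main: "norm (f w) \<le> 2 * M * exp (4 * \<epsilon> * Re w)" if M: "M > 0" "\<And>w. Re w = 0 \<Longrightarrow> norm (f w) \<le> M"
    and "\<epsilon> > 0" and "Re w > 0" for M \<epsilon>
  proof -
    obtain C where C: "\<And>w. Re w \<ge> 0 \<Longrightarrow> norm (f w) \<le> C * exp (\<epsilon> * norm w)"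
      using growth[OF \<open>\<epsilon> > 0\<close>] by blast
    define e where "e R v = (v\<^sup>2 + (of_real R)\<^sup>2) / (of_real R)\<^sup>2 *
      exp (- 4 * of_real \<epsilon> * ((of_real R)\<^sup>2 * v / (v\<^sup>2 + (of_real R)\<^sup>2)))" for R :: real and v :: complex
    have bound: "norm (f w * e R w) \<le> 2 * M"
      if R: "R > norm w" "C * exp (- \<epsilon> * R) \<le> M" for R
    proof -
      have "R > 0" using R(1) norm_ge_zero[of w] by linarith
      define S where "S = {v. Re v > 0} \<inter> ball 0 R"
      define T where "T = {v. Re v \<ge> 0} \<inter> cball 0 R"
      have "closed T" unfolding T_def by (intro closed_Int closed_halfspace_Re_ge closed_cball)
      have "S \<subseteq> T" by (auto simp: S_def T_def)
      then have ST: "closure S \<subseteq> T" using \<open>closed T\<close> closure_minimal by blast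
      have "open S" unfolding S_def by (intro open_Int open_halfspace_Re_gt open_ball)
      have sum_le: "norm (v\<^sup>2 + (of_real R)\<^sup>2) \<le> 2 * R\<^sup>2" if "norm v \<le> R" for v :: complex
      proof -
        have "norm (v\<^sup>2 + (of_real R)\<^sup>2) \<le> norm v ^ 2 + R\<^sup>2"
          using norm_triangle_ineq[of "v\<^sup>2" "(of_real R)\<^sup>2"] by (simp add: norm_power)
        moreover have "norm v ^ 2 \<le> R\<^sup>2" using that by (intro power_mono) auto
        ultimately show ?thesis by simp
      qed
      have Re_quot: "Re (of_real R ^ 2 * v / (v\<^sup>2 + (of_real R)\<^sup>2)) =
          R\<^sup>2 * ((norm v)\<^sup>2 + R\<^sup>2) * Re v / (norm (v\<^sup>2 + (of_real R)\<^sup>2))\<^sup>2" for v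
      proof -
        have "Re (of_real R ^ 2 * v * cnj (v\<^sup>2 + (of_real R)\<^sup>2)) = R\<^sup>2 * ((norm v)\<^sup>2 + R\<^sup>2) * Re v"
          unfolding cmod_power2 by (simp add: power2_eq_square algebra_simps)
        then show ?thesis by (subst complex_div_cnj) (simp add: Re_divide_of_real flip: of_real_power)
      qed
      have e_norm: "norm (e R v) = norm (v\<^sup>2 + (of_real R)\<^sup>2) / R\<^sup>2 *
          exp (- 4 * \<epsilon> * Re (of_real R ^ 2 * v / (v\<^sup>2 + (of_real R)\<^sup>2)))" for v
      proof -
        have Re4: "Re (- 4 * of_real \<epsilon> * x) = - 4 * \<epsilon> * Re x" for x :: complex by simp
        then show ?thesis
          unfolding e_def norm_mult norm_exp_eq_Re Re4 norm_divide norm_power by simp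
      qed
      have e_le: "norm (e R v) \<le> norm (v\<^sup>2 + (of_real R)\<^sup>2) / R\<^sup>2" if "Re v \<ge> 0" for v
        unfolding e_norm Re_quot using that \<open>\<epsilon> > 0\<close>
        by (intro mult_left_le) auto
      have "continuous_on T (e R)"
        unfolding continuous_on_def
      proof
        fix a assume "a \<in> T"
        show "(e R \<longlongrightarrow> e R a) (at a within T)"
        proof (cases "a\<^sup>2 + (of_real R)\<^sup>2 = 0")
          case True
          \<comment> \<open>Here \<open>a\<close> is a corner of the half-disc; the exponential in \<open>e R\<close> has modulus at most one,
            so the polynomial factor forces the limit zero.\<close>
          have "((\<lambda>v. norm (v\<^sup>2 + (of_real R)\<^sup>2) / R\<^sup>2) \<longlongrightarrow> norm (a\<^sup>2 + (of_real R)\<^sup>2) / R\<^sup>2) (at a within T)"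
            using \<open>R > 0\<close> by (intro tendsto_intros) auto
          then have "((\<lambda>v. norm (v\<^sup>2 + (of_real R)\<^sup>2) / R\<^sup>2) \<longlongrightarrow> 0) (at a within T)"
            using True by simp
          then have "(e R \<longlongrightarrow> 0) (at a within T)"
            by (rule Lim_null_comparison[rotated])
               (use e_le in \<open>auto simp: eventually_at_filter T_def intro!: always_eventually\<close>)
          then show ?thesis using True by (simp add: e_def)
        next
          case False
          then show ?thesis unfolding e_def using \<open>R > 0\<close>
            by (intro tendsto_intros) auto
        qed
      qed
      then have cont: "continuous_on (closure S) (\<lambda>v. f v * e R v)"
        using ST by (intro continuous_on_mult continuous_on_subset[OF f(2)])
          (auto simp: T_def intro: continuous_on_subset)
      have hol: "(\<lambda>v. f v * e R v) holomorphic_on interior S"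
      proof -
        have "v\<^sup>2 + (of_real R)\<^sup>2 \<noteq> 0" if "v \<in> S" for v
        proof
          assume "v\<^sup>2 + (of_real R)\<^sup>2 = 0"
          then have "v\<^sup>2 = (\<i> * of_real R)\<^sup>2" by (simp add: eq_neg_iff_add_eq_0 power_mult_distrib)
          then have "v = \<i> * of_real R \<or> v = - (\<i> * of_real R)" by (simp only: power2_eq_iff)
          then have "Re v = 0" by auto
          then show False using that by (simp add: S_def)
        qed
        then have "(\<lambda>v. f v * e R v) holomorphic_on S"
          unfolding e_def using \<open>R > 0\<close>
          by (intro holomorphic_intros holomorphic_on_subset[OF f(1)]) (auto simp: S_def)
        then show ?thesis using \<open>open S\<close> by (simp add: interior_open)
      qed
      have "bounded S" unfolding S_def by (simp add: bounded_Int)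
      have "w \<in> S" using \<open>Re w > 0\<close> R by (simp add: S_def)
      have frontier: "norm (f v * e R v) \<le> 2 * M" if "v \<in> frontier S" for v
      proof -
        have "v \<in> T" "v \<notin> S" using that ST \<open>open S\<close> by (auto simp: frontier_def interior_open)
        then have v: "Re v \<ge> 0" "norm v \<le> R" and "Re v = 0 \<or> norm v = R" by (auto simp: S_def T_def)
        then consider "Re v = 0" | "Re v > 0" "norm v = R" by force
        then show ?thesis
        proof cases
          case 1
          have "norm (e R v) \<le> 2"
            using e_le[OF v(1)] sum_le[OF v(2)] \<open>R > 0\<close>
            by (auto intro!: order_trans[OF e_le[OF v(1)]] simp: divide_simps)
          moreover have "norm (f v) \<le> M" using M 1 by blast
          ultimately have "norm (f v) * norm (e R v) \<le> M * 2" using M(1) by (intro mult_mono) auto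
          then show ?thesis by (simp add: norm_mult)
        next
          case 2
          have "v\<^sup>2 + (of_real R)\<^sup>2 = v * (2 * of_real (Re v))"
          proof -
            have "(of_real R)\<^sup>2 = v * cnj v" using complex_norm_square[of v] 2 by simp
            then have "v\<^sup>2 + (of_real R)\<^sup>2 = v * (v + cnj v)" by (simp add: power2_eq_square distrib_left)
            then show ?thesis by (simp add: complex_add_cnj)
          qed
          then have "of_real R ^ 2 * v / (v\<^sup>2 + (of_real R)\<^sup>2) = of_real (R\<^sup>2 / (2 * Re v))"
            using 2 \<open>R > 0\<close> by (auto simp: field_simps)
          then have ReV: "Re (of_real R ^ 2 * v / (v\<^sup>2 + (of_real R)\<^sup>2)) = R\<^sup>2 / (2 * Re v)" by simp
          have "Re v \<le> R" using complex_Re_le_cmod[of v] 2 by simp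
          then have "R * Re v \<le> R * R" using \<open>R > 0\<close> by simp
          then have "R / 2 \<le> R\<^sup>2 / (2 * Re v)"
            using 2 by (simp add: field_simps power2_eq_square)
          then have "exp (- 4 * \<epsilon> * (R\<^sup>2 / (2 * Re v))) \<le> exp (- 2 * \<epsilon> * R)"
            using \<open>\<epsilon> > 0\<close> mult_left_mono[of "R / 2" "R\<^sup>2 / (2 * Re v)" "4 * \<epsilon>"]
            by (simp add: mult_ac)
          then have "norm (e R v) \<le> 2 * exp (- 2 * \<epsilon> * R)"
            unfolding e_norm ReV using sum_le[OF v(2)] \<open>R > 0\<close>
            by (intro mult_mono) (auto simp: divide_simps)
          moreover have "norm (f v) \<le> C * exp (\<epsilon> * R)" using C[OF v(1)] 2 by simp
          ultimately have "norm (f v) * norm (e R v) \<le> (C * exp (\<epsilon> * R)) * (2 * exp (- 2 * \<epsilon> * R))"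
            by (intro mult_mono) (auto intro: order_trans[OF norm_ge_zero])
          also have "\<dots> = 2 * (C * (exp (\<epsilon> * R) * exp (- 2 * \<epsilon> * R)))" by simp
          also have "exp (\<epsilon> * R) * exp (- 2 * \<epsilon> * R) = exp (- \<epsilon> * R)" by (simp flip: exp_add)
          also have "2 * (C * exp (- \<epsilon> * R)) \<le> 2 * M" using R by simp
          finally show ?thesis by (simp add: norm_mult)
        qed
      qed
      show ?thesis
        by (rule maximum_modulus_frontier[OF hol cont \<open>bounded S\<close> frontier \<open>w \<in> S\<close>])
    qed
    have "((\<lambda>R. C * exp (- \<epsilon> * R)) \<longlongrightarrow> C * 0) at_top"
      using \<open>\<epsilon> > 0\<close> by (intro tendsto_mult tendsto_const) real_asymp
    then have "eventually (\<lambda>R. C * exp (- \<epsilon> * R) < M) at_top"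
      using M(1) by (intro order_tendstoD(2)) auto
    then have ev: "eventually (\<lambda>R. norm (f w * e R w) \<le> 2 * M) at_top"
      using eventually_gt_at_top[of "norm w"] by eventually_elim (intro bound, auto)
    have "((\<lambda>R. of_real (1 / R\<^sup>2) :: complex) \<longlongrightarrow> of_real 0) at_top"
      by (intro tendsto_of_real) real_asymp
    then have lim0: "((\<lambda>R. 1 / (of_real R)\<^sup>2 :: complex) \<longlongrightarrow> 0) at_top" by simp
    have "((\<lambda>R. (w\<^sup>2 * (1 / (of_real R)\<^sup>2) + 1) *
        exp (- 4 * of_real \<epsilon> * (w / (w\<^sup>2 * (1 / (of_real R)\<^sup>2) + 1)))) \<longlongrightarrow>
        (w\<^sup>2 * 0 + 1) * exp (- 4 * of_real \<epsilon> * (w / (w\<^sup>2 * 0 + 1)))) at_top"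
      by (intro tendsto_intros lim0) auto
    moreover have "eventually (\<lambda>R::real. (w\<^sup>2 * (1 / (of_real R)\<^sup>2) + 1) *
        exp (- 4 * of_real \<epsilon> * (w / (w\<^sup>2 * (1 / (of_real R)\<^sup>2) + 1))) = e R w) at_top"
      using eventually_gt_at_top[of 0]
    proof eventually_elim
      case (elim R)
      have 1: "w\<^sup>2 * (1 / (of_real R)\<^sup>2) + 1 = (w\<^sup>2 + (of_real R)\<^sup>2) / (of_real R)\<^sup>2"
        using elim by (simp add: field_simps)
      show ?case unfolding 1 e_def using elim by (simp add: mult.commute[of w])
    qed
    ultimately have "((\<lambda>R. e R w) \<longlongrightarrow> exp (- 4 * of_real \<epsilon> * w)) at_top"
      by (simp add: tendsto_cong)
    then have "((\<lambda>R. norm (f w * e R w)) \<longlongrightarrow> norm (f w * exp (- 4 * of_real \<epsilon> * w))) at_top"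
      by (intro tendsto_intros)
    then have "norm (f w * exp (- 4 * of_real \<epsilon> * w)) \<le> 2 * M"
      using ev by (intro tendsto_upperbound[where F = at_top]) auto
    then have "norm (f w) * exp (- (4 * \<epsilon> * Re w)) \<le> 2 * M" by (simp add: norm_mult)
    then show ?thesis by (simp add: exp_minus field_simps)
  qed
  have "norm (f w) \<le> 2 * M'" if "M' > M" "Re w > 0" for M'
  proof -
    have "norm (f 0) \<le> M" by (rule axis) simp
    then have "M \<ge> 0" using norm_ge_zero[of "f 0"] by linarith
    then have "eventually (\<lambda>\<epsilon>. norm (f w) \<le> 2 * M' * exp (4 * \<epsilon> * Re w)) (at_right 0)"
      using that axis by (intro eventually_at_rightI[of 0 1] main) (auto intro: order_trans less_imp_le)
    moreover have "((\<lambda>\<epsilon>. 2 * M' * exp (4 * \<epsilon> * Re w)) \<longlongrightarrow> 2 * M' * exp (4 * 0 * Re w)) (at_right 0)"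
      by (intro tendsto_intros)
    ultimately have "norm (f w) \<le> 2 * M' * exp (4 * 0 * Re w)"
      by (intro tendsto_lowerbound[where F = "at_right 0"]) auto
    then show ?thesis by simp
  qed
  note M'_bound = this
  have pos: "norm (f w) \<le> 2 * M" if "Re w > 0"
  proof (rule field_le_epsilon)
    fix e :: real assume "e > 0"
    then show "norm (f w) \<le> 2 * M + e" using M'_bound[of "M + e / 2"] that by simp
  qed
  show ?thesis
  proof (cases "Re w = 0")
    case True
    then show ?thesis using axis[of w] norm_ge_zero[of "f w"] by linarith
  qed (use pos assms in auto)
qed

section \<open>Entire functions of minimal type with positive zeros\<close>

text \<open>
  In the application \<open>\<Phi> (z\<^sup>2)\<close> is the even entire function \<open>F\<close> and \<open>s n\<close> is the square of the
  \<open>n\<close>-th positive zero of \<open>F\<close>. Zeros are listed with multiplicity, in any order.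
\<close>
locale positive_zeros =
  fixes \<Phi> :: "complex \<Rightarrow> complex" and s :: "nat \<Rightarrow> real"
  assumes holo: "\<Phi> holomorphic_on UNIV" and at_0: "\<Phi> 0 = 1"
    and growth: "minimal_type \<Phi>"
    and s_pos: "\<And>k. s k > 0"
    and zero_iff: "\<And>w. \<Phi> w = 0 \<longleftrightarrow> (\<exists>k. w = of_real (s k))"
    and zorder: "\<And>k. zorder \<Phi> (of_real (s k)) = int (card {j. s j = s k})"
    and summable: "summable (\<lambda>k. 1 / s k)"
begin

definition partial_product :: "real \<Rightarrow> complex \<Rightarrow> complex" where
  "partial_product \<rho> w = (\<Prod>k | s k \<le> \<rho>. 1 - w / of_real (s k))"

lemma finite_le: "finite {k. s k \<le> \<rho>}"
proof -
  have "(\<lambda>k. 1 / s k) \<longlonglongrightarrow> 0" using summable by (rule summable_LIMSEQ_zero)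
  then have "eventually (\<lambda>k. 1 / s k < 1 / max \<rho> 1) sequentially"
    by (rule order_tendstoD) auto
  then obtain N where N: "\<And>k. k \<ge> N \<Longrightarrow> 1 / s k < 1 / max \<rho> 1"
    unfolding eventually_sequentially by blast
  have "{k. s k \<le> \<rho>} \<subseteq> {..<N}"
  proof
    fix k assume "k \<in> {k. s k \<le> \<rho>}"
    then have "1 / max \<rho> 1 \<le> 1 / s k" using s_pos[of k] by (intro divide_left_mono) auto
    then show "k \<in> {..<N}" using N[of k] by force
  qed
  then show ?thesis by (rule finite_subset) simp
qed

lemma nonzero_left: "Re w \<le> 0 \<Longrightarrow> \<Phi> w \<noteq> 0"
  using s_pos unfolding zero_iff by (metis Re_complex_of_real not_le)

lemma norm_partial_product_ge_1:
  assumes "norm w = 2 * \<rho>" "\<rho> > 0"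
  shows "norm (partial_product \<rho> w) \<ge> 1"
  unfolding partial_product_def prod_norm[symmetric]
proof (rule prod_ge_1)
  fix k assume "k \<in> {k. s k \<le> \<rho>}"
  then have "norm (w / of_real (s k)) \<ge> 2" using assms s_pos[of k]
    by (simp add: norm_divide field_simps)
  then show "norm (1 - w / of_real (s k)) \<ge> 1"
    using norm_triangle_ineq2[of "w / of_real (s k)" 1] by (simp add: norm_minus_commute)
qed

text \<open>
  Dividing out all zeros up to a radius leaves an entire function without zeros in that disc.
\<close>
lemma cofactor:
  obtains H where "H holomorphic_on UNIV" "\<And>w. \<Phi> w = partial_product \<rho> w * H w" "H 0 = 1"
    "\<And>w. norm w \<le> \<rho> \<Longrightarrow> H w \<noteq> 0"
proof -
  define S where "S = {k. s k \<le> \<rho>}"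
  have [simp]: "finite S" unfolding S_def by (rule finite_le)
  define A where "A = (\<lambda>k. complex_of_real (s k)) ` S"
  have "0 \<notin> A" using s_pos by (auto simp: A_def less_le)
  then obtain H where H: "H holomorphic_on UNIV" "\<And>a. a \<in> A \<Longrightarrow> H a \<noteq> 0"
    "\<And>w. \<Phi> w = (\<Prod>a\<in>A. (1 - w / a) ^ nat (zorder \<Phi> a)) * H w"
    using divide_out_zeros[OF holo, of A] at_0 by (auto simp: A_def)
  have "(\<Prod>a\<in>A. (1 - w / a) ^ nat (zorder \<Phi> a)) = partial_product \<rho> w" for w
  proof -
    have "(\<Prod>a\<in>A. (1 - w / a) ^ nat (zorder \<Phi> a)) =
      (\<Prod>a\<in>A. \<Prod>k\<in>{k\<in>S. of_real (s k) = a}. 1 - w / of_real (s k))"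
    proof (rule prod.cong)
      fix a assume "a \<in> A"
      then obtain k where k: "k \<in> S" "a = of_real (s k)" by (auto simp: A_def)
      have "{j \<in> S. complex_of_real (s j) = a} = {j. s j = s k}"
        using k by (auto simp: S_def)
      then show "(1 - w / a) ^ nat (zorder \<Phi> a) =
          (\<Prod>k\<in>{k\<in>S. of_real (s k) = a}. 1 - w / of_real (s k))"
        using k by (simp add: zorder)
    qed simp
    also have "\<dots> = partial_product \<rho> w" unfolding A_def partial_product_def S_def[symmetric]
      by (subst prod.image_gen[of S _ "\<lambda>k. complex_of_real (s k)"]) auto
    finally show ?thesis .
  qed
  with H have eq: "\<Phi> w = partial_product \<rho> w * H w" for w by simp
  moreover have "H 0 = 1" using eq[of 0] at_0 by (simp add: partial_product_def)
  moreover have "H w \<noteq> 0" if "norm w \<le> \<rho>" for w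
  proof
    assume "H w = 0"
    then obtain k where k: "w = of_real (s k)" using eq[of w] zero_iff by auto
    then have "s k \<le> \<rho>" using that s_pos[of k] by simp
    then have "w \<in> A" using k by (auto simp: A_def S_def)
    then show False using H(2) \<open>H w = 0\<close> by blast
  qed
  ultimately show thesis using that H(1) by blast
qed

text \<open>
  This is the quantitative core of Hadamard's factorisation theorem. On the circle of radius \<open>4 R\<close>
  the partial product over zeros up to \<open>2 R\<close> has modulus at least one, so the cofactor \<open>H\<close> is bounded
  there by \<open>\<Phi>\<close>. Since \<open>H\<close> has no zeros in the disc of radius \<open>2 R\<close>, it has a logarithm \<open>g\<close> there, whose
  real part is small compared with \<open>R\<close>; the Borel-Caratheodory inequality then bounds \<open>g\<close> itself. The
  bound \<open>\<epsilon> * norm w\<close> serves both at a fixed point, where it gives convergence of the product, and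
  at \<open>norm w = R\<close>, where it is a lower bound for \<open>H\<close>.
\<close>
lemma eventually_cofactor_exp:
  assumes "\<epsilon> > 0"
  shows "eventually (\<lambda>R. \<exists>H g. H holomorphic_on UNIV \<and> (\<forall>w. \<Phi> w = partial_product (2 * R) w * H w) \<and>
    (\<forall>w. norm w \<le> R \<longrightarrow> H w = exp (g w) \<and> norm (g w) \<le> \<epsilon> * norm w)) at_top"
proof -
  \<comment> \<open>The Borel-Caratheodory inequality loses a factor of \<open>2\<close>, and it is applied with \<open>A = 8 * \<delta> * R\<close>,
    twice the exponent on the circle of radius \<open>4 * R\<close>, so as to absorb the constant \<open>C\<close>.\<close>
  define \<delta> where "\<delta> = \<epsilon> / 16"
  have "\<delta> > 0" using assms by (simp add: \<delta>_def)
  obtain C where C: "C > 0" "\<And>w. norm (\<Phi> w) \<le> C * exp (\<delta> * norm w)"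
    using minimal_typeE[OF growth \<open>\<delta> > 0\<close>] by blast
  have "filterlim (\<lambda>R. 4 * \<delta> * R) at_top at_top"
    using \<open>\<delta> > 0\<close> by real_asymp
  then have "eventually (\<lambda>R. 4 * \<delta> * R > ln C) at_top"
    by (simp add: filterlim_at_top_dense)
  then show ?thesis using eventually_gt_at_top[of 0]
  proof eventually_elim
    case (elim R)
    obtain H where H: "H holomorphic_on UNIV" "\<And>w. \<Phi> w = partial_product (2 * R) w * H w" "H 0 = 1"
      "\<And>w. norm w \<le> 2 * R \<Longrightarrow> H w \<noteq> 0" by (rule cofactor[of "2 * R"]) blast
    define A where "A = 8 * \<delta> * R"
    have "A > 0" using elim \<open>\<delta> > 0\<close> by (simp add: A_def)
    have H_le: "norm (H w) \<le> C * exp (4 * \<delta> * R)" if "norm w \<le> 4 * R" for w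
    proof (rule maximum_modulus_frontier[of H "cball 0 (4 * R)"])
      fix z :: complex assume "z \<in> frontier (cball 0 (4 * R))"
      then have z: "norm z = 2 * (2 * R)" using elim by (simp add: frontier_cball)
      then have "norm (partial_product (2 * R) z) \<ge> 1" using elim by (intro norm_partial_product_ge_1) auto
      then have "norm (H z) \<le> norm (\<Phi> z)"
        unfolding H(2) norm_mult by (simp add: mult_right_le_one_le mult_le_cancel_right1)
      also have "\<dots> \<le> C * exp (4 * \<delta> * R)" using C(2)[of z] z by (simp add: mult_ac)
      finally show "norm (H z) \<le> C * exp (4 * \<delta> * R)" .
    qed (use H(1) that in \<open>auto intro: holomorphic_on_subset holomorphic_on_imp_continuous_on\<close>)
    obtain G where G: "G holomorphic_on ball 0 (2 * R)" "\<And>w. w \<in> ball 0 (2 * R) \<Longrightarrow> H w = exp (G w)"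
      using contractible_imp_holomorphic_log[of H "ball 0 (2 * R)"] H
      by (auto simp: convex_imp_contractible intro: holomorphic_on_subset)
    define g where "g w = G w - G 0" for w
    have "exp (G 0) = 1" using G(2)[of 0] H(3) elim by simp
    then have g_exp: "H w = exp (g w)" if "norm w < 2 * R" for w
      using G(2)[of w] that by (simp add: g_def exp_diff)
    have g_hol: "g holomorphic_on ball 0 (2 * R)"
      unfolding g_def using G(1) by (intro holomorphic_intros)
    have Re_g: "Re (g w) < A" if "norm w < 2 * R" for w
    proof -
      have "exp (Re (g w)) = norm (H w)" using g_exp[OF that] by simp
      also have "\<dots> \<le> C * exp (4 * \<delta> * R)" using that elim by (intro H_le) auto
      also have "C < exp (4 * \<delta> * R)" using elim(1) C(1) by (metis exp_less_mono exp_ln)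
      then have "C * exp (4 * \<delta> * R) < exp (4 * \<delta> * R) * exp (4 * \<delta> * R)" by simp
      also have "\<dots> = exp A" by (simp add: A_def flip: exp_add)
      finally show ?thesis by simp
    qed
    have "norm (g w) \<le> \<epsilon> * norm w" if "norm w \<le> R" for w
    proof -
      have "norm (g w) * R \<le> norm (g w) * (2 * R - norm w)" using that by (intro mult_left_mono) auto
      also have "\<dots> \<le> 2 * A * norm w"
        using that elim \<open>A > 0\<close> Re_g by (intro borel_caratheodory g_hol) (auto simp: g_def)
      also have "\<dots> = \<epsilon> * norm w * R" by (simp add: A_def \<delta>_def)
      finally show ?thesis using elim by simp
    qed
    moreover have "H w = exp (g w)" if "norm w \<le> R" for w
      using that elim by (intro g_exp) auto
    ultimately show ?case using H by blast
  qed
qed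

lemma partial_product_tendsto: "((\<lambda>R. partial_product (2 * R) w) \<longlongrightarrow> \<Phi> w) at_top"
proof (rule tendstoI)
  fix e :: real assume "e > 0"
  have "isCont (\<lambda>u. \<Phi> w * exp (- u)) 0" by (intro continuous_intros)
  then obtain d where d: "d > 0" "\<And>u. norm u < d \<Longrightarrow> dist (\<Phi> w * exp (- u)) (\<Phi> w) < e"
    using \<open>e > 0\<close> unfolding continuous_at_eps_delta by (force simp: dist_norm)
  define \<epsilon> where "\<epsilon> = d / (norm w + 1)"
  have "norm w + 1 > 0" using norm_ge_zero[of w] by linarith
  then have "\<epsilon> > 0" "\<epsilon> * norm w < d" using d(1) by (auto simp: \<epsilon>_def field_simps)
  show "eventually (\<lambda>R. dist (partial_product (2 * R) w) (\<Phi> w) < e) at_top"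
    using eventually_cofactor_exp[OF \<open>\<epsilon> > 0\<close>] eventually_ge_at_top[of "norm w"]
  proof eventually_elim
    case (elim R)
    then obtain u where "\<Phi> w = partial_product (2 * R) w * exp u" "norm u \<le> \<epsilon> * norm w" by metis
    then have "partial_product (2 * R) w = \<Phi> w * exp (- u)" "norm u < d"
      using \<open>\<epsilon> * norm w < d\<close> by (auto simp: exp_minus field_simps)
    then show ?case using d by simp
  qed
qed

lemma real_on_reals: "\<Phi> (of_real x) \<in> \<real>"
proof (rule Lim_in_closed_set[OF closed_complex_Reals _ _ partial_product_tendsto])
  show "eventually (\<lambda>R. partial_product (2 * R) (of_real x) \<in> \<real>) at_top"
    by (intro always_eventually allI) (simp add: partial_product_def prod_in_Reals)
qed simp

lemma norm_factor_mono:
  assumes "Re w \<le> 0" "0 \<le> t" "t \<le> 1"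
  shows "norm (1 - of_real t * w / of_real (s k)) \<le> norm (1 - w / of_real (s k))"
proof -
  define x y where "x = - Re w / s k" and "y = Im w / s k"
  have "x \<ge> 0" using assms s_pos[of k] by (simp add: x_def divide_nonpos_pos)
  have "(1 + t * x)\<^sup>2 + (t * y)\<^sup>2 \<le> (1 + x)\<^sup>2 + y\<^sup>2"
  proof (intro add_mono)
    have "t * x \<le> x" "0 \<le> t * x" using assms \<open>x \<ge> 0\<close> by (auto simp: mult_left_le_one_le)
    then show "(1 + t * x)\<^sup>2 \<le> (1 + x)\<^sup>2" by (intro power_mono) auto
    show "(t * y)\<^sup>2 \<le> y\<^sup>2"
      using assms by (simp add: power_mult_distrib mult_left_le_one_le power_le_one)
  qed
  then show ?thesis
    by (simp add: cmod_def x_def y_def Re_divide_of_real Im_divide_of_real)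
qed

text \<open>
  Dividing by the two products gives an upper bound for the ratio \<open>\<Phi> (t w) / \<Phi> w\<close>: by
  \<open>norm_factor_mono\<close> every omitted factor contributes at most one to it. With \<open>T\<close> empty this is
  monotonicity along rays; large sets \<open>T\<close> give decay.
\<close>
lemma norm_ratio_le:
  assumes "Re w \<le> 0" "0 \<le> t" "t \<le> 1" "finite T"
  shows "norm (\<Phi> (of_real t * w)) * (\<Prod>k\<in>T. norm (1 - w / of_real (s k))) \<le>
         norm (\<Phi> w) * (\<Prod>k\<in>T. norm (1 - of_real t * w / of_real (s k)))"
proof (rule tendsto_le)
  show "((\<lambda>R. norm (partial_product (2 * R) (of_real t * w)) * (\<Prod>k\<in>T. norm (1 - w / of_real (s k)))) \<longlongrightarrow>
    norm (\<Phi> (of_real t * w)) * (\<Prod>k\<in>T. norm (1 - w / of_real (s k)))) at_top"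
    by (intro tendsto_intros partial_product_tendsto)
  show "((\<lambda>R. norm (partial_product (2 * R) w) * (\<Prod>k\<in>T. norm (1 - of_real t * w / of_real (s k)))) \<longlongrightarrow>
    norm (\<Phi> w) * (\<Prod>k\<in>T. norm (1 - of_real t * w / of_real (s k)))) at_top"
    by (intro tendsto_intros partial_product_tendsto)
  show "eventually (\<lambda>R. norm (partial_product (2 * R) (of_real t * w)) * (\<Prod>k\<in>T. norm (1 - w / of_real (s k))) \<le>
    norm (partial_product (2 * R) w) * (\<Prod>k\<in>T. norm (1 - of_real t * w / of_real (s k)))) at_top"
    using eventually_ge_at_top[of "sum s T"]
  proof eventually_elim
    case (elim R)
    define S where "S = {k. s k \<le> 2 * R}"
    have fin: "finite S" unfolding S_def by (rule finite_le)
    have "T \<subseteq> S"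
    proof
      fix k assume "k \<in> T"
      then have "s k \<le> sum s T" using \<open>finite T\<close> s_pos by (intro member_le_sum) (auto intro: less_imp_le)
      then show "k \<in> S" using elim s_pos[of k] by (simp add: S_def)
    qed
    have split: "norm (partial_product (2 * R) v) = (\<Prod>k\<in>S - T. norm (1 - v / of_real (s k))) *
      (\<Prod>k\<in>T. norm (1 - v / of_real (s k)))" for v
      unfolding partial_product_def S_def[symmetric] prod_norm[symmetric]
      by (rule prod.subset_diff[OF \<open>T \<subseteq> S\<close> fin])
    have "(\<Prod>k\<in>S - T. norm (1 - of_real t * w / of_real (s k))) \<le>
        (\<Prod>k\<in>S - T. norm (1 - w / of_real (s k)))"
      using assms by (intro prod_mono conjI norm_ge_zero norm_factor_mono)
    then have "(\<Prod>k\<in>S - T. norm (1 - of_real t * w / of_real (s k))) *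
        ((\<Prod>k\<in>T. norm (1 - of_real t * w / of_real (s k))) * (\<Prod>k\<in>T. norm (1 - w / of_real (s k)))) \<le>
        (\<Prod>k\<in>S - T. norm (1 - w / of_real (s k))) *
        ((\<Prod>k\<in>T. norm (1 - of_real t * w / of_real (s k))) * (\<Prod>k\<in>T. norm (1 - w / of_real (s k))))"
      by (intro mult_right_mono mult_nonneg_nonneg prod_nonneg) auto
    then show ?case unfolding split by (simp only: mult_ac)
  qed
qed simp

lemma norm_mono_left:
  assumes "Re w \<le> 0" "0 \<le> t" "t \<le> 1"
  shows "norm (\<Phi> (of_real t * w)) \<le> norm (\<Phi> w)"
  using norm_ratio_le[OF assms, of "{}"] by simp

text \<open>
  Along the negative axis each factor of the ratio tends to \<open>t\<close>, and there are infinitely many of them,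
  so the limit is at most \<open>t ^ m\<close> for every \<open>m\<close>.
\<close>
lemma ratio_tendsto_0:
  assumes "0 \<le> t" "t < 1"
  shows "(\<lambda>n. \<Phi> (of_real t * - of_nat n) / \<Phi> (- of_nat n)) \<longlonglongrightarrow> 0"
proof (rule tendstoI)
  fix e :: real assume "e > 0"
  have "(\<lambda>m. t ^ m) \<longlonglongrightarrow> 0" using assms by (intro LIMSEQ_realpow_zero) auto
  then have "eventually (\<lambda>m. t ^ m < e) sequentially" using \<open>e > 0\<close> by (rule order_tendstoD)
  then obtain m where m: "t ^ m < e" unfolding eventually_sequentially by blast
  define q where "q k n = norm (1 - of_real t * - of_nat n / of_real (s k) :: complex) /
    norm (1 - - of_nat n / of_real (s k) :: complex)" for k n
  have q: "q k n = (1 + t * real n / s k) / (1 + real n / s k)" for k n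
  proof -
    have "1 - of_real t * - of_nat n / of_real (s k) = complex_of_real (1 + t * real n / s k)"
      "1 - - of_nat n / of_real (s k) = complex_of_real (1 + real n / s k)" by simp_all
    moreover have "1 + t * real n / s k \<ge> 0" "1 + real n / s k \<ge> 0"
      using assms s_pos[of k] by (auto intro!: add_nonneg_nonneg divide_nonneg_nonneg)
    ultimately show ?thesis unfolding q_def by (simp only: norm_of_real abs_of_nonneg)
  qed
  have "(\<lambda>n. q k n) \<longlonglongrightarrow> t" for k
    unfolding q using s_pos[of k] by real_asymp
  then have "(\<lambda>n. \<Prod>k<m. q k n) \<longlonglongrightarrow> (\<Prod>k<m. t)" by (intro tendsto_prod)
  then have "(\<lambda>n. \<Prod>k<m. q k n) \<longlonglongrightarrow> t ^ m" by simp
  then have "eventually (\<lambda>n. (\<Prod>k<m. q k n) < e) sequentially" using m by (rule order_tendstoD)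
  then show "eventually (\<lambda>n. dist (\<Phi> (of_real t * - of_nat n) / \<Phi> (- of_nat n)) 0 < e) sequentially"
  proof eventually_elim
    case (elim n)
    have pos: "(\<Prod>k<m. norm (1 - - of_nat n / of_real (s k) :: complex)) > 0"
    proof (rule prod_pos)
      fix k
      have "1 - - of_nat n / of_real (s k) = complex_of_real (1 + real n / s k)" by simp
      moreover have "1 + real n / s k > 0"
        using s_pos[of k] by (intro add_pos_nonneg) auto
      ultimately show "norm (1 - - of_nat n / of_real (s k) :: complex) > 0"
        by (simp only: norm_of_real)
    qed
    have nz: "\<Phi> (- of_nat n) \<noteq> 0" by (intro nonzero_left) simp
    have "norm (\<Phi> (of_real t * - of_nat n)) * (\<Prod>k<m. norm (1 - - of_nat n / of_real (s k) :: complex)) \<le>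
         norm (\<Phi> (- of_nat n)) * (\<Prod>k<m. norm (1 - of_real t * - of_nat n / of_real (s k) :: complex))"
      using assms by (intro norm_ratio_le) auto
    then have "norm (\<Phi> (of_real t * - of_nat n)) / norm (\<Phi> (- of_nat n)) \<le> (\<Prod>k<m. q k n)"
      using pos nz unfolding q_def prod_dividef by (simp add: divide_simps mult_ac del: of_real_of_nat_eq)
    then show ?case using elim by (simp add: norm_divide)
  qed
qed

text \<open>
  No lower bound for \<open>\<Phi>\<close> is available near its zeros. Instead the partial product is cancelled first: on the
  circle of radius \<open>4 R\<close> it has modulus at least one, and the maximum principle carries the resulting
  bound for \<open>h * H\<close> to the disc of radius \<open>R\<close>, where \<open>H\<close> is bounded from below.
\<close>
lemma minimal_type_quotient:
  assumes h: "h holomorphic_on UNIV" and "minimal_type (\<lambda>w. h w * \<Phi> w)"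
  shows "minimal_type h"
  unfolding minimal_type_def
proof (intro allI impI)
  fix \<epsilon> :: real assume "\<epsilon> > 0"
  then have "\<epsilon> / 8 > 0" "\<epsilon> / 2 > 0" by auto
  obtain C where C: "C > 0" "\<And>w. norm (h w * \<Phi> w) \<le> C * exp (\<epsilon> / 8 * norm w)"
    using minimal_typeE[OF assms(2) \<open>\<epsilon> / 8 > 0\<close>] by blast
  obtain R0 where R0: "\<And>R. R \<ge> R0 \<Longrightarrow> \<exists>H g. H holomorphic_on UNIV \<and> (\<forall>w. \<Phi> w = partial_product (2 * R) w * H w) \<and>
    (\<forall>w. norm w \<le> R \<longrightarrow> H w = exp (g w) \<and> norm (g w) \<le> \<epsilon> / 2 * norm w)"
    using eventually_cofactor_exp[OF \<open>\<epsilon> / 2 > 0\<close>] unfolding eventually_at_top_linorder by blast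
  define R1 where "R1 = max R0 1"
  have bound: "norm (h w) \<le> C * exp (\<epsilon> * R)" if "R \<ge> R1" "norm w \<le> R" for R w
  proof -
    have "R > 0" "R \<ge> R0" using that by (auto simp: R1_def)
    then obtain H g where H: "H holomorphic_on UNIV" "\<And>w. \<Phi> w = partial_product (2 * R) w * H w"
      "\<And>w. norm w \<le> R \<Longrightarrow> H w = exp (g w) \<and> norm (g w) \<le> \<epsilon> / 2 * norm w"
      using R0 by metis
    have "norm (h w * H w) \<le> C * exp (\<epsilon> / 2 * R)"
    proof (rule maximum_modulus_frontier[of "\<lambda>w. h w * H w" "cball 0 (4 * R)"])
      show "(\<lambda>w. h w * H w) holomorphic_on interior (cball 0 (4 * R))"
        by (intro holomorphic_on_mult holomorphic_on_subset[OF h] holomorphic_on_subset[OF H(1)]) auto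
      show "continuous_on (closure (cball 0 (4 * R))) (\<lambda>w. h w * H w)"
        by (intro holomorphic_on_imp_continuous_on holomorphic_on_mult
            holomorphic_on_subset[OF h] holomorphic_on_subset[OF H(1)]) auto
      fix z :: complex assume "z \<in> frontier (cball 0 (4 * R))"
      then have z: "norm z = 2 * (2 * R)" using \<open>R > 0\<close> by (simp add: frontier_cball)
      then have "norm (partial_product (2 * R) z) \<ge> 1" using \<open>R > 0\<close> by (intro norm_partial_product_ge_1) auto
      then have "norm (H z) \<le> norm (\<Phi> z)"
        unfolding H(2) norm_mult by (simp add: mult_right_le_one_le mult_le_cancel_right1)
      then have "norm (h z * H z) \<le> norm (h z * \<Phi> z)"
        unfolding norm_mult by (intro mult_left_mono) auto
      also have "\<dots> \<le> C * exp (\<epsilon> / 2 * R)" using C(2)[of z] z by (simp add: mult_ac)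
      finally show "norm (h z * H z) \<le> C * exp (\<epsilon> / 2 * R)" .
    qed (use that \<open>R > 0\<close> in auto)
    moreover have "norm (H w) \<ge> exp (- (\<epsilon> / 2 * R))"
    proof -
      have "- Re (g w) \<le> norm (g w)" using abs_Re_le_cmod[of "g w"] by linarith
      also have "\<dots> \<le> \<epsilon> / 2 * norm w" using H(3) that by blast
      also have "\<dots> \<le> \<epsilon> / 2 * R" using that \<open>\<epsilon> > 0\<close> by (intro mult_left_mono) auto
      finally show ?thesis using H(3) that by simp
    qed
    then have "norm (h w) * exp (- (\<epsilon> / 2 * R)) \<le> norm (h w * H w)"
      unfolding norm_mult by (intro mult_left_mono) auto
    ultimately have "norm (h w) * exp (- (\<epsilon> / 2 * R)) \<le> C * exp (\<epsilon> / 2 * R)" by linarith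
    then have "norm (h w) \<le> C * (exp (\<epsilon> / 2 * R) * exp (\<epsilon> / 2 * R))"
      by (simp add: exp_minus field_simps)
    also have "exp (\<epsilon> / 2 * R) * exp (\<epsilon> / 2 * R) = exp (\<epsilon> * R)" by (simp flip: exp_add)
    finally show ?thesis .
  qed
  show "\<exists>C. \<forall>w. norm (h w) \<le> C * exp (\<epsilon> * norm w)"
  proof (intro exI[of _ "C * exp (\<epsilon> * R1)"] allI)
    fix w :: complex
    have "norm (h w) \<le> C * exp (\<epsilon> * (R1 + norm w))"
      by (rule bound) (auto simp: R1_def)
    then show "norm (h w) \<le> C * exp (\<epsilon> * R1) * exp (\<epsilon> * norm w)"
      by (simp add: distrib_left exp_add)
  qed
qed

text \<open>
  The quotient \<open>h = K / \<Phi>\<close> is entire of minimal type, of at most linear growth on the left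
  half-plane by hypothesis and on the right half-plane by Phragmen-Lindelof, hence affine; the
  hypothesis on the negative axis removes its linear term.
\<close>
lemma eq_multiple_of_dominated:
  assumes K: "K holomorphic_on UNIV" "minimal_type K"
    and vanish: "\<And>k. K (of_real (s k)) = 0" and inj: "inj s"
    and left: "\<And>w. Re w \<le> 0 \<Longrightarrow> norm (K w) \<le> C * (1 + norm w) * norm (\<Phi> w)"
    and axis: "(\<lambda>n. K (- of_nat n) / (of_nat n * \<Phi> (- of_nat n))) \<longlonglongrightarrow> 0"
  shows "K w = K 0 * \<Phi> w"
proof -
  have simple: "deriv \<Phi> (of_real (s k)) \<noteq> 0" for k
  proof -
    have "zorder \<Phi> (of_real (s k)) = 1" using inj by (simp add: zorder inj_eq)
    define b where "b = complex_of_real (s k)"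
    have "b \<noteq> 0" using s_pos[of k] by (simp add: b_def)
    then obtain g where g: "g holomorphic_on UNIV" "g b \<noteq> 0"
        "\<And>w. \<Phi> w = (1 - w / b) ^ nat (zorder \<Phi> b) * g w"
      using divide_out_zero[OF holo, of b] at_0 by auto
    then have eq: "\<Phi> = (\<lambda>w. (1 - w / b) * g w)"
      using \<open>zorder \<Phi> (of_real (s k)) = 1\<close> by (auto simp: b_def)
    have "(g has_field_derivative deriv g b) (at b)"
      using g(1) by (simp add: holomorphic_derivI)
    then have "((\<lambda>w. (1 - w / b) * g w) has_field_derivative - g b / b) (at b)"
      using \<open>b \<noteq> 0\<close> by (auto intro!: derivative_eq_intros simp: field_simps)
    then have "deriv \<Phi> b = - g b / b" unfolding eq by (rule DERIV_imp_deriv)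
    then show ?thesis using g(2) \<open>b \<noteq> 0\<close> by (simp add: b_def)
  qed
  obtain h where h: "h holomorphic_on UNIV" "\<And>w. K w = h w * \<Phi> w"
    using entire_quotient[OF K(1) holo] vanish simple by (metis zero_iff)
  have hmin: "minimal_type h"
  proof (rule minimal_type_quotient[OF h(1)])
    have "K = (\<lambda>w. h w * \<Phi> w)" using h by auto
    then show "minimal_type (\<lambda>w. h w * \<Phi> w)" using K(2) by simp
  qed
  have left': "norm (h w) \<le> C * (1 + norm w)" if "Re w \<le> 0" for w
    using left[OF that] nonzero_left[OF that] by (simp add: h(2) norm_mult)
  have "norm (h 0) \<le> C" using left'[of 0] by simp
  then have "C \<ge> 0" using norm_ge_zero[of "h 0"] by linarith
  have right: "norm (h w) \<le> 4 * C * (1 + norm w)" if "Re w \<ge> 0" for w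
  proof -
    have ge: "norm (1 + v) \<ge> 1" if "Re v \<ge> 0" for v
      using complex_Re_le_cmod[of "1 + v"] that by simp
    have nz: "1 + v \<noteq> 0" if "Re v \<ge> 0" for v
      using ge[OF that] by auto
    have "norm (h w / (1 + w)) \<le> 2 * (2 * C)"
    proof (rule phragmen_lindelof_half_plane[where f = "\<lambda>w. h w / (1 + w)"])
      show "(\<lambda>w. h w / (1 + w)) holomorphic_on {w. 0 < Re w}"
        using nz by (intro holomorphic_intros holomorphic_on_subset[OF h(1)]) auto
      have "(\<lambda>w. h w / (1 + w)) holomorphic_on {w. 0 \<le> Re w}"
        using nz by (intro holomorphic_intros holomorphic_on_subset[OF h(1)]) auto
      then show "continuous_on {w. 0 \<le> Re w} (\<lambda>w. h w / (1 + w))"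
        by (rule holomorphic_on_imp_continuous_on)
      show "\<exists>C. \<forall>w. 0 \<le> Re w \<longrightarrow> norm (h w / (1 + w)) \<le> C * exp (\<epsilon> * norm w)" if eps: "\<epsilon> > 0" for \<epsilon>
      proof -
        obtain C where C: "\<And>w. norm (h w) \<le> C * exp (\<epsilon> * norm w)"
          using minimal_typeE[OF hmin eps] by blast
        have "norm (h w / (1 + w)) \<le> C * exp (\<epsilon> * norm w)" if "0 \<le> Re w" for w
        proof -
          have "norm (h w / (1 + w)) \<le> norm (h w)"
            unfolding norm_divide using ge[OF that] by (simp add: divide_le_eq mult_le_cancel_left1)
          then show ?thesis using C[of w] by linarith
        qed
        then show ?thesis by blast
      qed
      show "norm (h v / (1 + v)) \<le> 2 * C" if "Re v = 0" for v
      proof -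
        have "norm v \<le> norm (1 + v)"
          using that by (simp add: cmod_def real_le_rsqrt)
        then have "1 + norm v \<le> 2 * norm (1 + v)" using ge[of v] that by simp
        then have "C * (1 + norm v) \<le> C * (2 * norm (1 + v))" using \<open>C \<ge> 0\<close> by (rule mult_left_mono)
        then have "norm (h v) \<le> 2 * C * norm (1 + v)" using left'[of v] that by simp
        then show ?thesis using nz[of v] that by (simp add: norm_divide divide_le_eq)
      qed
    qed (use that in auto)
    then have "norm (h w) \<le> 4 * C * norm (1 + w)"
      using nz[OF that] by (simp add: norm_divide divide_le_eq)
    also have "\<dots> \<le> 4 * C * (1 + norm w)"
      using \<open>C \<ge> 0\<close> norm_triangle_ineq[of 1 w] by (intro mult_left_mono) auto
    finally show ?thesis .
  qed
  have lin: "norm (h w) \<le> 8 * C * norm w ^ 1" if "1 \<le> norm w" for w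
  proof -
    have "norm (h w) \<le> 4 * C * (1 + norm w)"
      using left'[of w] right[of w] \<open>C \<ge> 0\<close>
      by (cases "Re w \<ge> 0") (auto intro: order_trans[OF left'[of w]] mult_right_mono)
    also have "\<dots> \<le> 4 * C * (2 * norm w)" using that \<open>C \<ge> 0\<close> by (intro mult_left_mono) auto
    finally show ?thesis by simp
  qed
  define c where "c = deriv h 0"
  have h_eq: "h w = h 0 + c * w" for w
    using Liouville_polynomial[OF h(1) lin, where \<xi> = w] by (simp add: c_def)
  have "(\<lambda>n. h (- of_nat n) / of_nat n) \<longlonglongrightarrow> 0"
  proof (rule Lim_transform_eventually[OF axis], rule always_eventually, rule allI)
    fix n
    show "K (- of_nat n) / (of_nat n * \<Phi> (- of_nat n)) = h (- of_nat n) / of_nat n"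
      using nonzero_left[of "- of_nat n"] by (simp add: h(2))
  qed
  moreover have "(\<lambda>n. h (- of_nat n) / of_nat n) \<longlonglongrightarrow> - c"
  proof -
    have "(\<lambda>n. h 0 * (1 / of_nat n) - c) \<longlonglongrightarrow> h 0 * 0 - c"
      by (intro tendsto_intros lim_1_over_n)
    moreover have "eventually (\<lambda>n. h 0 * (1 / of_nat n) - c = h (- of_nat n) / of_nat n) sequentially"
      using eventually_gt_at_top[of 0]
    proof eventually_elim
      case (elim n)
      then show ?case by (subst h_eq) (simp add: field_simps)
    qed
    ultimately show ?thesis by (simp add: tendsto_cong)
  qed
  ultimately have "c = 0" using LIMSEQ_unique by fastforce
  then show ?thesis using h(2)[of w] h(2)[of 0] h_eq[of w] at_0 by simp
qed

end

section \<open>Integral transforms that vanish at the zeros\<close>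

text \<open>
  No density is fixed here: the recurrence below holds for every nonzero finite orthogonality
  measure without atoms on the unit interval, and only its moments enter.
\<close>
locale unit_interval_measure =
  fixes M :: "real measure"
  assumes sets_M [measurable_cong, simp]: "sets M = sets borel"
    and AE_unit: "AE t in M. 0 < t \<and> t < 1"

locale zero_transform = positive_zeros \<Phi> s + unit_interval_measure M for \<Phi> s M
begin

definition taylor :: "nat \<Rightarrow> complex" where "taylor k = (deriv ^^ k) \<Phi> 0 / fact k"

definition transform :: "(real \<Rightarrow> complex) \<Rightarrow> complex \<Rightarrow> complex" where
  "transform \<phi> w = (\<integral>t. \<Phi> (of_real (t\<^sup>2) * w) * \<phi> t \<partial>M)"

definition moment :: "(real \<Rightarrow> complex) \<Rightarrow> nat \<Rightarrow> complex" where
  "moment \<phi> k = (\<integral>t. of_real (t ^ (2 * k)) * \<phi> t \<partial>M)"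

lemma taylor_sums: "(\<lambda>k. taylor k * w ^ k) sums \<Phi> w"
  using holomorphic_power_series[of \<Phi> 0 "norm w + 1" w] holo
  by (simp add: taylor_def holomorphic_on_subset)

lemma taylor_0: "taylor 0 = 1"
  by (simp add: taylor_def at_0)

lemma summable_norm_taylor: "Series.summable (\<lambda>k. norm (taylor k * w ^ k))"
proof (rule powser_insidea)
  show "Series.summable (\<lambda>k. taylor k * of_real (norm w + 1) ^ k)"
    using taylor_sums by (rule sums_summable)
  have "norm (of_real (norm w + 1) :: complex) = norm w + 1"
    unfolding norm_of_real by simp
  then show "norm w < norm (of_real (norm w + 1) :: complex)" by simp
qed

lemma
  assumes \<phi>: "integrable M \<phi>"
  shows transform_sums: "(\<lambda>k. taylor k * moment \<phi> k * w ^ k) sums transform \<phi> w"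
    and transform_integrable: "integrable M (\<lambda>t. \<Phi> (of_real (t\<^sup>2) * w) * \<phi> t)"
proof -
  have [measurable]: "\<phi> \<in> borel_measurable M" using \<phi> by auto
  define f where "f k t = taylor k * (of_real (t\<^sup>2) * w) ^ k * \<phi> t" for k t
  have [measurable]: "f k \<in> borel_measurable M" for k
    unfolding f_def by measurable
  have le: "norm (f k t) \<le> norm (taylor k * w ^ k) * norm (\<phi> t)" if "0 < t" "t < 1" for k t
  proof -
    have "norm (of_real (t\<^sup>2) * w :: complex) ^ k \<le> norm w ^ k"
      using that by (intro power_mono) (auto simp: norm_mult norm_power mult_left_le_one_le power_le_one)
    then show ?thesis unfolding f_def norm_mult norm_power
      by (intro mult_right_mono mult_left_mono) (auto simp: norm_mult norm_power)
  qed
  have AE_le: "AE t in M. norm (f k t) \<le> norm (taylor k * w ^ k) * norm (\<phi> t)" for k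
    using AE_unit by eventually_elim (use le in auto)
  have bnd: "integrable M (\<lambda>t. norm (taylor k * w ^ k) * norm (\<phi> t))" for k
    using \<phi> by (intro integrable_mult_right integrable_norm)
  have int: "integrable M (f k)" for k
    by (rule Bochner_Integration.integrable_bound[OF bnd]) (use AE_le in auto)
  have s1: "AE t in M. Series.summable (\<lambda>k. norm (f k t))"
    using AE_unit
  proof eventually_elim
    case (elim t)
    have "Series.summable (\<lambda>k. norm (taylor k * w ^ k) * norm (\<phi> t))"
      by (intro summable_mult2 summable_norm_taylor)
    then show ?case by (rule summable_comparison_test') (use le elim in auto)
  qed
  have s2: "Series.summable (\<lambda>k. \<integral>t. norm (f k t) \<partial>M)"
  proof (rule summable_comparison_test')
    show "Series.summable (\<lambda>k. norm (taylor k * w ^ k) * (\<integral>t. norm (\<phi> t) \<partial>M))"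
      by (intro summable_mult2 summable_norm_taylor)
    fix k
    have "(\<integral>t. norm (f k t) \<partial>M) \<le> (\<integral>t. norm (taylor k * w ^ k) * norm (\<phi> t) \<partial>M)"
      by (intro integral_mono_AE bnd integrable_norm int AE_le)
    then show "norm (\<integral>t. norm (f k t) \<partial>M) \<le> norm (taylor k * w ^ k) * (\<integral>t. norm (\<phi> t) \<partial>M)"
      by simp
  qed
  have sum: "(\<Sum>k. f k t) = \<Phi> (of_real (t\<^sup>2) * w) * \<phi> t" for t
    unfolding f_def using taylor_sums by (intro sums_unique[symmetric] sums_mult2)
  show "integrable M (\<lambda>t. \<Phi> (of_real (t\<^sup>2) * w) * \<phi> t)"
    using integrable_suminf[OF int s1 s2] by (simp add: sum)
  have "integral\<^sup>L M (f k) = taylor k * moment \<phi> k * w ^ k" for k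
  proof -
    have "f k = (\<lambda>t. taylor k * w ^ k * (of_real (t ^ (2 * k)) * \<phi> t))"
      by (simp add: f_def fun_eq_iff power_mult_distrib mult_2 mult_2_right power_add power2_eq_square mult_ac)
    then have "integral\<^sup>L M (f k) = (\<integral>t. taylor k * w ^ k * (of_real (t ^ (2 * k)) * \<phi> t) \<partial>M)" by simp
    also have "\<dots> = taylor k * w ^ k * moment \<phi> k"
      unfolding moment_def by (rule integral_mult_right_zero)
    finally show ?thesis by simp
  qed
  then show "(\<lambda>k. taylor k * moment \<phi> k * w ^ k) sums transform \<phi> w"
    using sums_integral[OF int s1 s2] by (simp add: sum transform_def)
qed

lemma transform_holomorphic: "integrable M \<phi> \<Longrightarrow> transform \<phi> holomorphic_on UNIV"
  by (rule entire_power_series[OF transform_sums])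

lemma transform_bound:
  assumes \<phi>: "integrable M \<phi>"
    and B: "\<And>t. 0 < t \<Longrightarrow> t < 1 \<Longrightarrow> norm (\<Phi> (of_real (t\<^sup>2) * w)) \<le> B"
  shows "norm (transform \<phi> w) \<le> B * (\<integral>t. norm (\<phi> t) \<partial>M)"
proof -
  have "norm (transform \<phi> w) \<le> (\<integral>t. norm (\<Phi> (of_real (t\<^sup>2) * w) * \<phi> t) \<partial>M)"
    unfolding transform_def by (rule integral_norm_bound)
  also have "\<dots> \<le> (\<integral>t. B * norm (\<phi> t) \<partial>M)"
  proof (rule integral_mono_AE)
    show "AE t in M. norm (\<Phi> (of_real (t\<^sup>2) * w) * \<phi> t) \<le> B * norm (\<phi> t)"
      using AE_unit by eventually_elim (use B in \<open>auto simp: norm_mult intro!: mult_right_mono\<close>)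
  qed (use \<phi> transform_integrable in auto)
  finally show ?thesis by simp
qed

lemma minimal_type_transform:
  assumes \<phi>: "integrable M \<phi>"
  shows "minimal_type (transform \<phi>)"
  unfolding minimal_type_def
proof (intro allI impI)
  fix \<epsilon> :: real assume "\<epsilon> > 0"
  obtain C where C: "C > 0" "\<And>w. norm (\<Phi> w) \<le> C * exp (\<epsilon> * norm w)"
    using minimal_typeE[OF growth \<open>\<epsilon> > 0\<close>] by blast
  show "\<exists>C. \<forall>w. norm (transform \<phi> w) \<le> C * exp (\<epsilon> * norm w)"
  proof (intro exI[of _ "C * (\<integral>t. norm (\<phi> t) \<partial>M)"] allI)
    fix w
    have "norm (transform \<phi> w) \<le> (C * exp (\<epsilon> * norm w)) * (\<integral>t. norm (\<phi> t) \<partial>M)"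
    proof (rule transform_bound[OF \<phi>])
      fix t :: real assume t: "0 < t" "t < 1"
      have "norm (of_real (t\<^sup>2) * w :: complex) \<le> norm w"
        using t by (auto simp: norm_mult norm_power mult_left_le_one_le power_le_one)
      then have "C * exp (\<epsilon> * norm (of_real (t\<^sup>2) * w :: complex)) \<le> C * exp (\<epsilon> * norm w)"
        using C \<open>\<epsilon> > 0\<close> by simp
      then show "norm (\<Phi> (of_real (t\<^sup>2) * w)) \<le> C * exp (\<epsilon> * norm w)"
        using C(2)[of "of_real (t\<^sup>2) * w"] by linarith
    qed
    then show "norm (transform \<phi> w) \<le> C * (\<integral>t. norm (\<phi> t) \<partial>M) * exp (\<epsilon> * norm w)"
      by (simp add: mult_ac)
  qed
qed

text \<open>
  Monotonicity of \<open>\<Phi>\<close> along rays is what makes the left half-plane special.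
\<close>
lemma transform_le_left:
  assumes "integrable M \<phi>" "Re w \<le> 0"
  shows "norm (transform \<phi> w) \<le> (\<integral>t. norm (\<phi> t) \<partial>M) * norm (\<Phi> w)"
proof -
  have "norm (transform \<phi> w) \<le> norm (\<Phi> w) * (\<integral>t. norm (\<phi> t) \<partial>M)"
    using assms by (intro transform_bound norm_mono_left) (auto simp: power_le_one)
  then show ?thesis by (simp add: mult.commute)
qed

lemma transform_ratio_tendsto_0:
  assumes \<phi>: "integrable M \<phi>"
  shows "(\<lambda>n. transform \<phi> (- of_nat n) / \<Phi> (- of_nat n)) \<longlonglongrightarrow> 0"
proof -
  define f where "f n t = \<Phi> (of_real (t\<^sup>2) * - of_nat n) * \<phi> t / \<Phi> (- of_nat n)" for n t
  have "(\<lambda>n. \<integral>t. f n t \<partial>M) \<longlonglongrightarrow> (\<integral>t. 0 \<partial>M)"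
  proof (rule integral_dominated_convergence)
    show "integrable M (\<lambda>t. norm (\<phi> t))" using \<phi> by (rule integrable_norm)
    have "integrable M (f n)" for n
      unfolding f_def by (intro integrable_divide transform_integrable \<phi>)
    then show "f n \<in> borel_measurable M" for n by auto
    show "AE t in M. (\<lambda>n. f n t) \<longlonglongrightarrow> 0"
      using AE_unit
    proof eventually_elim
      case (elim t)
      then have "(\<lambda>n. \<Phi> (of_real (t\<^sup>2) * - of_nat n) / \<Phi> (- of_nat n)) \<longlonglongrightarrow> 0"
        by (intro ratio_tendsto_0) (auto simp: power_less_one_iff)
      then have "(\<lambda>n. \<Phi> (of_real (t\<^sup>2) * - of_nat n) / \<Phi> (- of_nat n) * \<phi> t) \<longlonglongrightarrow> 0 * \<phi> t"
        by (intro tendsto_intros)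
      then show ?case by (simp add: f_def)
    qed
    show "AE t in M. norm (f n t) \<le> norm (\<phi> t)" for n
      using AE_unit
    proof eventually_elim
      case (elim t)
      have "norm (\<Phi> (of_real (t\<^sup>2) * - of_nat n)) \<le> norm (\<Phi> (- of_nat n))"
        using elim by (intro norm_mono_left) (auto simp: power_le_one)
      then have "norm (\<Phi> (of_real (t\<^sup>2) * - of_nat n)) * norm (\<phi> t) \<le> norm (\<Phi> (- of_nat n)) * norm (\<phi> t)"
        by (rule mult_right_mono) simp
      then show ?case using nonzero_left[of "- of_nat n"]
        by (simp add: f_def norm_mult norm_divide divide_le_eq mult.commute)
    qed
  qed simp
  moreover have "(\<integral>t. f n t \<partial>M) = transform \<phi> (- of_nat n) / \<Phi> (- of_nat n)" for n
    unfolding f_def transform_def by (rule integral_divide_zero)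
  ultimately show ?thesis by simp
qed

text \<open>
  A combination of transforms that vanishes at all zeros is a multiple of \<open>\<Phi>\<close>; the conclusion
  compares the coefficients of \<open>w ^ Suc k\<close> on both sides.
\<close>
lemma coeff_identity_of_vanishing:
  assumes \<phi>: "integrable M \<phi>" and \<psi>: "integrable M \<psi>" and "inj s"
    and vanish: "\<And>k. transform \<phi> (of_real (s k)) + of_real (s k) * transform \<psi> (of_real (s k)) = 0"
  shows "taylor (Suc k) * moment \<phi> (Suc k) + taylor k * moment \<psi> k = moment \<phi> 0 * taylor (Suc k)"
proof -
  define K where "K w = transform \<phi> w + w * transform \<psi> w" for w
  define a where "a k = taylor k * moment \<phi> k + (case k of 0 \<Rightarrow> 0 | Suc j \<Rightarrow> taylor j * moment \<psi> j)" for k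
  have K_sums: "(\<lambda>k. a k * w ^ k) sums K w" for w
  proof -
    have "(\<lambda>k. w * (taylor k * moment \<psi> k * w ^ k)) sums (w * transform \<psi> w)"
      by (intro sums_mult transform_sums \<psi>)
    then have "(\<lambda>k. (case Suc k of 0 \<Rightarrow> 0 | Suc j \<Rightarrow> taylor j * moment \<psi> j) * w ^ Suc k) sums (w * transform \<psi> w)"
      by (simp add: mult_ac)
    then have "(\<lambda>k. (case k of 0 \<Rightarrow> 0 | Suc j \<Rightarrow> taylor j * moment \<psi> j) * w ^ k) sums (w * transform \<psi> w)"
      by (subst (asm) sums_Suc_iff) simp
    from sums_add[OF transform_sums[OF \<phi>] this] show ?thesis
      by (simp add: a_def K_def distrib_right)
  qed
  have "K w = K 0 * \<Phi> w" for w
  proof (rule eq_multiple_of_dominated)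
    show "K holomorphic_on UNIV" using K_sums by (rule entire_power_series)
    show "minimal_type K" unfolding K_def
      by (intro minimal_type_add minimal_type_times_id minimal_type_transform \<phi> \<psi>)
    show "K (of_real (s k)) = 0" for k using vanish by (simp add: K_def)
    define I where "I \<phi> = (\<integral>t. norm (\<phi> t) \<partial>M)" for \<phi> :: "real \<Rightarrow> complex"
    have I: "I \<phi> \<ge> 0" for \<phi> unfolding I_def by simp
    show "norm (K w) \<le> (I \<phi> + I \<psi>) * (1 + norm w) * norm (\<Phi> w)" if "Re w \<le> 0" for w
    proof -
      have "norm (K w) \<le> norm (transform \<phi> w) + norm w * norm (transform \<psi> w)"
        unfolding K_def by (rule norm_triangle_le) (simp add: norm_mult)
      also have "\<dots> \<le> I \<phi> * norm (\<Phi> w) + norm w * (I \<psi> * norm (\<Phi> w))"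
        unfolding I_def using transform_le_left[OF \<phi> that] transform_le_left[OF \<psi> that]
        by (intro add_mono mult_left_mono) auto
      also have "\<dots> = (I \<phi> + norm w * I \<psi>) * norm (\<Phi> w)" by (simp add: algebra_simps)
      also have "\<dots> \<le> ((I \<phi> + I \<psi>) * (1 + norm w)) * norm (\<Phi> w)"
        using I[of \<phi>] I[of \<psi>] by (intro mult_right_mono) (auto simp: algebra_simps)
      finally show ?thesis .
    qed
    show "(\<lambda>n. K (- of_nat n) / (of_nat n * \<Phi> (- of_nat n))) \<longlonglongrightarrow> 0"
    proof (rule Lim_transform_eventually)
      have "(\<lambda>n. 1 / of_nat n * (transform \<phi> (- of_nat n) / \<Phi> (- of_nat n)) -
        transform \<psi> (- of_nat n) / \<Phi> (- of_nat n)) \<longlonglongrightarrow> 0 * 0 - 0"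
        by (intro tendsto_intros lim_1_over_n transform_ratio_tendsto_0 \<phi> \<psi>)
      then show "(\<lambda>n. 1 / of_nat n * (transform \<phi> (- of_nat n) / \<Phi> (- of_nat n)) -
        transform \<psi> (- of_nat n) / \<Phi> (- of_nat n)) \<longlonglongrightarrow> 0" by simp
      show "eventually (\<lambda>n. 1 / of_nat n * (transform \<phi> (- of_nat n) / \<Phi> (- of_nat n)) -
        transform \<psi> (- of_nat n) / \<Phi> (- of_nat n) = K (- of_nat n) / (of_nat n * \<Phi> (- of_nat n))) sequentially"
        using eventually_gt_at_top[of 0]
      proof eventually_elim
        case (elim n)
        then show ?case using nonzero_left[of "- of_nat n"]
          by (simp add: K_def field_simps)
      qed
    qed
  qed (use \<open>inj s\<close> in auto)
  moreover have "K 0 = moment \<phi> 0"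
    using at_0 by (simp add: K_def transform_def moment_def)
  ultimately have "(\<lambda>k. (moment \<phi> 0 * taylor k) * w ^ k) sums K w" for w
    using sums_mult[OF taylor_sums[of w], of "moment \<phi> 0"] by (simp add: mult.assoc)
  then have "a = (\<lambda>k. moment \<phi> 0 * taylor k)"
    using K_sums by (intro power_series_coeff_unique) auto
  then have "a (Suc k) = moment \<phi> 0 * taylor (Suc k)" by simp
  then show ?thesis by (simp add: a_def)
qed

end

locale orthogonal_zeros = zero_transform \<Phi> s M + finite_measure M for \<Phi> s M +
  assumes no_atoms: "\<And>x. emeasure M {x} = 0" and nonnull: "emeasure M (space M) \<noteq> 0"
    and orthogonal: "\<And>n m. n \<noteq> m \<Longrightarrow>
      (\<integral>t. \<Phi> (of_real (t\<^sup>2) * of_real (s n)) * \<Phi> (of_real (t\<^sup>2) * of_real (s m)) \<partial>M) = 0"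
begin

lemma integrable_bounded:
  assumes "continuous_on UNIV g"
  shows "integrable M (\<lambda>t. g t :: complex)"
proof -
  have "compact (g ` {0..1})"
    by (intro compact_continuous_image continuous_on_subset[OF assms]) auto
  then obtain B where B: "\<And>x. x \<in> {0..1} \<Longrightarrow> norm (g x) \<le> B"
    by (meson bounded_iff compact_imp_bounded imageI)
  show ?thesis
  proof (rule integrable_const_bound[of _ B])
    show "AE t in M. norm (g t) \<le> B"
      using AE_unit by eventually_elim (use B in auto)
    have "g \<in> borel_measurable borel" using assms by (rule borel_measurable_continuous_onI)
    then show "g \<in> borel_measurable M" by simp
  qed
qed

lemma continuous_\<Phi>: "continuous_on UNIV \<Phi>"
  using holo by (rule holomorphic_on_imp_continuous_on)

definition dilation :: "nat \<Rightarrow> real \<Rightarrow> complex" where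
  "dilation n t = \<Phi> (of_real (t\<^sup>2) * of_real (s n))"

lemma continuous_dilation: "continuous_on UNIV (dilation n)"
  unfolding dilation_def
  by (rule continuous_on_compose2[OF continuous_\<Phi>]) (auto intro!: continuous_intros)

text \<open>
  If \<open>s n = s m\<close> with \<open>n \<noteq> m\<close>, orthogonality says that the square of a real continuous function has
  integral zero. The function then vanishes almost everywhere, but its zeros are countable.
\<close>
lemma inj_s: "inj s"
proof (rule injI, rule ccontr)
  fix n m assume eq: "s n = s m" and "n \<noteq> m"
  define r where "r t = Re (dilation n t)" for t
  have dilation_r: "dilation n t = of_real (r t)" for t
  proof -
    have "dilation n t \<in> \<real>" unfolding dilation_def of_real_mult[symmetric] by (rule real_on_reals)
    then show ?thesis by (simp add: r_def)
  qed
  have "integrable M (\<lambda>t. dilation n t * dilation n t)"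
    by (intro integrable_bounded continuous_intros continuous_dilation)
  then have "integrable M (\<lambda>t. complex_of_real (r t * r t))" by (simp add: dilation_r)
  then have int: "integrable M (\<lambda>t. r t * r t)" by (simp only: complex_of_real_integrable_eq)
  have "complex_of_real (\<integral>t. r t * r t \<partial>M) = (\<integral>t. dilation n t * dilation m t \<partial>M)"
    using eq by (simp add: dilation_r dilation_def flip: integral_complex_of_real) (simp flip: dilation_r add: dilation_def)
  also have "\<dots> = 0" using orthogonal[OF \<open>n \<noteq> m\<close>] by (simp add: dilation_def)
  finally have "(\<integral>t. r t * r t \<partial>M) = 0" by simp
  then have "AE t in M. r t * r t = 0"
    using integral_nonneg_eq_0_iff_AE[OF int] by simp
  then have "AE t in M. dilation n t = 0 \<and> 0 < t"
    using AE_unit by eventually_elim (simp add: dilation_r)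
  then have range: "AE t in M. t \<in> range (\<lambda>k. sqrt (s k / s n))"
  proof eventually_elim
    case (elim t)
    then obtain k where "of_real (t\<^sup>2) * of_real (s n) = complex_of_real (s k)"
      unfolding dilation_def zero_iff by blast
    then have "t\<^sup>2 * s n = s k" by (simp only: of_real_mult[symmetric] of_real_eq_iff)
    then have "t = sqrt (s k / s n)" using s_pos[of n] elim by (simp add: real_sqrt_unique field_simps)
    then show ?case by blast
  qed
  have null: "range (\<lambda>k. sqrt (s k / s n)) \<in> null_sets M"
  proof -
    have "(\<Union>k. {sqrt (s k / s n)}) \<in> null_sets M"
      by (intro null_sets_UN) (auto simp: null_sets_def no_atoms)
    then show ?thesis by (simp add: UNION_singleton_eq_range)
  qed
  have "AE t in M. False"
    using range AE_not_in[OF null] by eventually_elim blast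
  then have "ae_filter M = bot" by (simp only: eventually_False)
  then show False using nonnull by (simp only: ae_filter_eq_bot_iff)
qed

text \<open>
  By orthogonality \<open>transform (dilation n)\<close> vanishes at all zeros except \<open>s n\<close>, and the factor
  \<open>1 - w / s n\<close> supplies the missing zero. The identity is the coefficient of \<open>w\<close> in the resulting
  proportionality to \<open>\<Phi>\<close>.
\<close>
lemma first_coeff_identity:
  "of_real (s n) * taylor 1 * (moment (dilation n) 1 - moment (dilation n) 0) = moment (dilation n) 0"
proof -
  have nz: "complex_of_real (s n) \<noteq> 0" using s_pos[of n] by simp
  have dilation: "integrable M (dilation n)" by (intro integrable_bounded continuous_dilation)
  define \<psi> where "\<psi> t = - (1 / of_real (s n)) * dilation n t" for t
  have \<psi>: "integrable M \<psi>" unfolding \<psi>_def using dilation by (intro integrable_mult_right)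
  have tr: "transform \<psi> w = - (1 / of_real (s n)) * transform (dilation n) w" for w
    unfolding transform_def \<psi>_def by (subst integral_mult_right_zero[symmetric]) (simp add: mult_ac)
  have mom: "moment \<psi> k = - (1 / of_real (s n)) * moment (dilation n) k" for k
    unfolding moment_def \<psi>_def by (subst integral_mult_right_zero[symmetric]) (simp add: mult_ac)
  have "taylor (Suc 0) * moment (dilation n) (Suc 0) + taylor 0 * moment \<psi> 0 = moment (dilation n) 0 * taylor (Suc 0)"
  proof (rule coeff_identity_of_vanishing[OF dilation \<psi> inj_s])
    fix k
    show "transform (dilation n) (of_real (s k)) + of_real (s k) * transform \<psi> (of_real (s k)) = 0"
    proof (cases "k = n")
      case True
      then show ?thesis using nz by (simp add: tr)
    next
      case False
      then have "transform (dilation n) (of_real (s k)) = 0"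
        using orthogonal[OF False] by (simp add: transform_def dilation_def)
      then show ?thesis by (simp add: tr)
    qed
  qed
  then show ?thesis using nz by (simp add: mom taylor_0 field_simps)
qed

text \<open>
  \<open>first_coeff_identity\<close> says that \<open>- T 1 + c 1 * w * T (t\<^sup>2 - 1)\<close> vanishes at every zero, where \<open>T\<close>
  is the transform and \<open>c 1\<close> the first Taylor coefficient. In contrast to the functions used there, its Taylor
  coefficients involve only the moments of the measure.
\<close>
theorem coeff_recurrence:
  fixes m defines "m k \<equiv> (\<integral>t. t ^ (2 * k) \<partial>M)"
  shows "taylor (Suc k) * of_real (m 0 - m (Suc k)) = taylor 1 * taylor k * of_real (m k - m (Suc k))"
proof -
  define \<psi> where "\<psi> t = taylor 1 * (of_real (t\<^sup>2) - 1)" for t :: real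
  have \<psi>: "integrable M \<psi>" unfolding \<psi>_def by (intro integrable_bounded continuous_intros)
  have one: "integrable M (\<lambda>_. - 1 :: complex)" by simp
  have pow: "integrable M (\<lambda>t. complex_of_real (t ^ j))" for j
    by (intro integrable_bounded continuous_intros)
  have m: "complex_of_real (m j) = (\<integral>t. of_real (t ^ (2 * j)) \<partial>M)" for j
    unfolding m_def by (rule integral_complex_of_real[symmetric])
  have mom1: "moment (\<lambda>_. - 1) j = - of_real (m j)" for j
    unfolding moment_def m by simp
  have mom\<psi>: "moment \<psi> j = taylor 1 * of_real (m (Suc j) - m j)" for j
  proof -
    have "moment \<psi> j = (\<integral>t. taylor 1 * (of_real (t ^ (2 * Suc j)) - of_real (t ^ (2 * j))) \<partial>M)"
      unfolding moment_def \<psi>_def by (simp add: algebra_simps power2_eq_square)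
    also have "\<dots> = taylor 1 * (of_real (m (Suc j)) - of_real (m j))"
      unfolding m by (subst integral_mult_right_zero, subst Bochner_Integration.integral_diff[OF pow pow]) simp
    finally show ?thesis by simp
  qed
  have "taylor (Suc k) * moment (\<lambda>_. - 1) (Suc k) + taylor k * moment \<psi> k = moment (\<lambda>_. - 1) 0 * taylor (Suc k)"
  proof (rule coeff_identity_of_vanishing[OF one \<psi> inj_s])
    fix n
    have "transform (\<lambda>_. - 1) (of_real (s n)) = - moment (dilation n) 0"
      by (simp add: transform_def moment_def dilation_def)
    moreover have "transform \<psi> (of_real (s n)) = taylor 1 * (moment (dilation n) 1 - moment (dilation n) 0)"
    proof -
      have "transform \<psi> (of_real (s n)) = (\<integral>t. taylor 1 * (of_real (t ^ 2) * dilation n t - dilation n t) \<partial>M)"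
        unfolding transform_def \<psi>_def dilation_def by (simp add: algebra_simps)
      also have "\<dots> = taylor 1 * ((\<integral>t. of_real (t ^ 2) * dilation n t \<partial>M) - (\<integral>t. dilation n t \<partial>M))"
        by (subst integral_mult_right_zero, subst Bochner_Integration.integral_diff)
          (auto intro!: integrable_bounded continuous_intros continuous_dilation)
      finally show ?thesis by (simp add: moment_def)
    qed
    ultimately show "transform (\<lambda>_. - 1) (of_real (s n)) + of_real (s n) * transform \<psi> (of_real (s n)) = 0"
      using first_coeff_identity[of n] by (simp add: mult.assoc)
  qed
  then show ?thesis unfolding mom1 mom\<psi> by (simp add: algebra_simps)
qed

end

section \<open>The beta weight as orthogonality measure\<close>

definition beta_measure :: "real \<Rightarrow> real \<Rightarrow> real measure" where
  "beta_measure a b = density lborel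
     (\<lambda>t. ennreal (indicator {0<..<1} t * (t powr (a - 1) * (1 - t) powr (b - 1))))"

lemma sets_beta_measure [measurable_cong, simp]: "sets (beta_measure a b) = sets borel"
  and space_beta_measure [simp]: "space (beta_measure a b) = UNIV"
  by (simp_all add: beta_measure_def)

lemma integral_beta_measure:
  fixes g :: "real \<Rightarrow> 'a :: {banach, second_countable_topology}"
  assumes [measurable]: "g \<in> borel_measurable borel"
  shows "(\<integral>t. g t \<partial>beta_measure a b) =
    (LBINT t:{0<..<1}. (t powr (a - 1) * (1 - t) powr (b - 1)) *\<^sub>R g t)"
  unfolding beta_measure_def set_lebesgue_integral_def
  by (subst integral_density) (auto simp: mult_ac)

lemma unit_interval_beta_measure: "unit_interval_measure (beta_measure a b)"
proof
  have "AE t in lborel. 0 < ennreal (indicator {0<..<1} t * (t powr (a - 1) * (1 - t) powr (b - 1))) \<longrightarrow>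
    0 < t \<and> t < 1"
    by (intro AE_I2) (auto simp: indicator_def)
  then show "AE t in beta_measure a b. 0 < t \<and> t < 1"
    unfolding beta_measure_def by (subst AE_density) auto
qed simp

lemma beta_measure_no_atoms: "emeasure (beta_measure a b) {x} = 0"
proof -
  have "absolutely_continuous lborel (beta_measure a b)"
    unfolding beta_measure_def by (rule absolutely_continuousI_density) measurable
  moreover have "{x} \<in> null_sets lborel" by (simp add: null_sets_def)
  ultimately have "{x} \<in> null_sets (beta_measure a b)"
    unfolding absolutely_continuous_def by blast
  then show ?thesis by (rule null_setsD1)
qed

lemma
  fixes a b :: real
  assumes "a > 0" "b > 0"
  shows set_integrable_Beta: "set_integrable lborel {0<..<1} (\<lambda>t. t powr (a - 1) * (1 - t) powr (b - 1))"
    and set_integral_Beta: "(LBINT t:{0<..<1}. t powr (a - 1) * (1 - t) powr (b - 1)) = Beta a b"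
proof -
  show int: "set_integrable lborel {0<..<1} (\<lambda>t. t powr (a - 1) * (1 - t) powr (b - 1))"
    using integrable_Beta[OF assms] by (rule set_integrable_subset) auto
  have "((\<lambda>t. t powr (a - 1) * (1 - t) powr (b - 1)) has_integral Beta a b) {0<..<1}"
    using has_integral_Beta_real[OF assms] by (simp add: has_integral_Icc_iff_Ioo)
  then show "(LBINT t:{0<..<1}. t powr (a - 1) * (1 - t) powr (b - 1)) = Beta a b"
    using set_borel_integral_eq_integral(2)[OF int] by (simp add: integral_unique)
qed

lemma beta_measure_moment:
  assumes "a > 0" "b > 0"
  shows "(\<integral>t. t ^ k \<partial>beta_measure a b) = Beta (a + real k) b"
proof -
  have "(\<integral>t. t ^ k \<partial>beta_measure a b) =
      (LBINT t:{0<..<1}. (t powr (a - 1) * (1 - t) powr (b - 1)) * t ^ k)"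
    by (subst integral_beta_measure) auto
  also have "\<dots> = (LBINT t:{0<..<1}. t powr (a + real k - 1) * (1 - t) powr (b - 1))"
  proof (rule set_lebesgue_integral_cong)
    show "\<forall>t. t \<in> {0<..<1} \<longrightarrow> t powr (a - 1) * (1 - t) powr (b - 1) * t ^ k =
      t powr (a + real k - 1) * (1 - t) powr (b - 1)"
    proof (intro allI impI)
      fix t :: real assume "t \<in> {0<..<1}"
      then have "t powr (a + real k - 1) = t powr (a - 1) * t ^ k"
        by (subst powr_realpow[symmetric]) (auto simp: algebra_simps simp flip: powr_add)
      then show "t powr (a - 1) * (1 - t) powr (b - 1) * t ^ k =
        t powr (a + real k - 1) * (1 - t) powr (b - 1)" by simp
    qed
  qed simp
  also have "\<dots> = Beta (a + real k) b" using assms by (intro set_integral_Beta) auto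
  finally show ?thesis .
qed

lemma finite_beta_measure:
  assumes "a > 0" "b > 0"
  shows "finite_measure (beta_measure a b)"
proof
  have "integrable lborel (\<lambda>t. indicator {0<..<1} t * (t powr (a - 1) * (1 - t) powr (b - 1)))"
    using set_integrable_Beta[OF assms] by (simp add: set_integrable_def)
  then have "(\<integral>\<^sup>+t. ennreal (indicator {0<..<1} t * (t powr (a - 1) * (1 - t) powr (b - 1))) \<partial>lborel) < \<infinity>"
    by (subst nn_integral_eq_integral) auto
  then show "emeasure (beta_measure a b) (space (beta_measure a b)) \<noteq> \<infinity>"
    by (simp add: beta_measure_def emeasure_density)
qed

lemma beta_measure_nonnull:
  assumes "a > 0" "b > 0"
  shows "emeasure (beta_measure a b) (space (beta_measure a b)) \<noteq> 0"
proof
  interpret finite_measure "beta_measure a b" using assms by (rule finite_beta_measure)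
  assume "emeasure (beta_measure a b) (space (beta_measure a b)) = 0"
  then have "measure (beta_measure a b) UNIV = 0" by (simp add: measure_def)
  moreover have "measure (beta_measure a b) UNIV = Beta a b"
    using beta_measure_moment[OF assms, of 0] by simp
  moreover have "Beta a b > 0" using assms by (simp add: Beta_def)
  ultimately show False by simp
qed

section \<open>Beta moments and the coefficient recurrence\<close>

lemma Beta_plus_nat:
  fixes a b :: real
  assumes "a > 0" "b > 0"
  shows "Beta (a + real k) b * pochhammer (a + b) k = pochhammer a k * Beta a b"
proof (induction k)
  case (Suc k)
  have "a + real k \<notin> \<int>\<^sub>\<le>\<^sub>0" using assms by (auto elim!: nonpos_Ints_cases)
  then have "(a + real k + b) * Beta (a + real k + 1) b = (a + real k) * Beta (a + real k) b"
    by (rule Beta_plus1_left)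
  then have "Beta (a + real (Suc k)) b * (a + b + real k) = (a + real k) * Beta (a + real k) b"
    by (simp add: algebra_simps)
  then have "Beta (a + real (Suc k)) b * pochhammer (a + b) (Suc k) =
      (a + real k) * (Beta (a + real k) b * pochhammer (a + b) k)"
    by (simp add: pochhammer_Suc)
  then show ?case unfolding Suc.IH by (simp add: pochhammer_Suc)
qed simp

lemma pochhammer_strict_mono:
  fixes x y :: real
  assumes "0 < x" "x < y" "k > 0"
  shows "pochhammer x k < pochhammer y k"
  unfolding pochhammer_prod
  by (rule prod_mono_strict[of 0]) (use assms in auto)

text \<open>
  With \<open>P\<close> and \<open>Q\<close> the Pochhammer symbols of \<open>\<mu>\<close> and \<open>\<mu> + \<beta> + 1\<close>, the moments are proportional to
  \<open>P (2 k) / Q (2 k)\<close>, and the numerator of \<open>m k - m (k + 1)\<close> factors because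
  \<open>(x + b) * (x + b + 1) - x * (x + 1) = b * (2 * x + b + 1)\<close>, here with \<open>x = \<mu> + 2 k\<close> and \<open>b = \<beta> + 1\<close>.
\<close>
lemma even_coeff_unique:
  fixes c :: "nat \<Rightarrow> complex"
  assumes "\<mu> > 0" "\<beta> > -1" and c0: "c 0 = 1" and c1: "c 1 = a / 2"
    and m: "\<And>k. m k = Beta (\<mu> + 2 * real k) (\<beta> + 1)"
    and rec: "\<And>k. c (Suc k) * of_real (m 0 - m (Suc k)) = c 1 * c k * of_real (m k - m (Suc k))"
  shows "c k = even_coeff a \<beta> \<mu> k"
proof (induction k)
  case 0
  then show ?case by (simp add: even_coeff_def c0)
next
  case (Suc k)
  define P Q where "P = pochhammer \<mu>" and "Q = pochhammer (\<mu> + \<beta> + 1)"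
  define B where "B = Beta \<mu> (\<beta> + 1)"
  have "B > 0" using assms by (simp add: B_def Beta_def)
  have Qpos: "Q j > 0" for j unfolding Q_def using assms by (intro pochhammer_pos) auto
  have PQ: "P (2 * Suc k) < Q (2 * Suc k)"
    unfolding P_def Q_def using assms by (intro pochhammer_strict_mono) auto
  have mPQ: "m j = B * P (2 * j) / Q (2 * j)" for j
    using Beta_plus_nat[of \<mu> "\<beta> + 1" "2 * j"] assms(1,2) Qpos[of "2 * j"]
    by (simp add: m P_def Q_def B_def field_simps add.assoc)
  have Pk: "P (2 * Suc k) = P (2 * k) * ((\<mu> + 2 * real k) * (\<mu> + 2 * real k + 1))"
    by (simp add: P_def pochhammer_Suc mult_ac add_ac)
  have Qk: "Q (2 * Suc k) = Q (2 * k) * ((\<mu> + \<beta> + 1 + 2 * real k) * (\<mu> + \<beta> + 1 + 2 * real k + 1))"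
    by (simp add: Q_def pochhammer_Suc mult_ac add_ac)
  define q where "q = (\<beta> + 2 * (\<mu> + 2 * real (Suc k) - 1)) * P (2 * k) / (Q (2 * Suc k) - P (2 * Suc k))"
  have m1: "(m 0 - m (Suc k)) * Q (2 * Suc k) = B * (Q (2 * Suc k) - P (2 * Suc k))"
    using Qpos[of "2 * Suc k"] unfolding mPQ by (simp add: P_def Q_def field_simps)
  have m2: "(m k - m (Suc k)) * Q (2 * Suc k) =
      B * ((\<beta> + 1) * (\<beta> + 2 * (\<mu> + 2 * real (Suc k) - 1)) * P (2 * k))"
  proof -
    have "m (Suc k) * Q (2 * Suc k) = B * P (2 * Suc k)"
      unfolding mPQ using Qpos[of "2 * Suc k"] by simp
    moreover have "m k * Q (2 * Suc k) =
        B * P (2 * k) * ((\<mu> + \<beta> + 1 + 2 * real k) * (\<mu> + \<beta> + 1 + 2 * real k + 1))"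
      unfolding mPQ Qk using Qpos[of "2 * k"] by simp
    ultimately show ?thesis unfolding left_diff_distrib Pk by (simp add: algebra_simps)
  qed
  have "m 0 - m (Suc k) \<noteq> 0" using m1 \<open>B > 0\<close> PQ by auto
  have ratio: "(m k - m (Suc k)) = (\<beta> + 1) * q * (m 0 - m (Suc k))"
  proof -
    have "(m k - m (Suc k)) * Q (2 * Suc k) = (\<beta> + 1) * q * (m 0 - m (Suc k)) * Q (2 * Suc k)"
      unfolding m2 mult.assoc[of _ "m 0 - m (Suc k)"] m1 q_def using PQ by (simp add: field_simps)
    then show ?thesis using Qpos[of "2 * Suc k"] by simp
  qed
  have "c (Suc k) * of_real (m 0 - m (Suc k)) =
      (a / 2 * of_real (\<beta> + 1) * of_real q * c k) * of_real (m 0 - m (Suc k))"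
    unfolding rec c1 ratio by (simp only: of_real_mult mult_ac)
  then have "c (Suc k) = a * of_real (\<beta> + 1) / 2 * of_real q * c k"
    using \<open>m 0 - m (Suc k) \<noteq> 0\<close> by (simp add: mult_ac del: of_real_diff)
  also have "\<dots> = even_coeff a \<beta> \<mu> (Suc k)"
  proof -
    define r where "r j = (\<beta> + 2 * (\<mu> + 2 * real j - 1)) * pochhammer \<mu> (2 * (j - 1)) /
      (pochhammer (\<mu> + \<beta> + 1) (2 * j) - pochhammer \<mu> (2 * j))" for j
    have even: "even_coeff a \<beta> \<mu> n = (a * of_real (\<beta> + 1) / 2) ^ n * of_real (\<Prod>j=1..n. r j)" for n
      by (simp only: even_coeff_def r_def)
    have "r (Suc k) = q" by (simp add: r_def q_def P_def Q_def)
    then show ?thesis unfolding Suc.IH even prod.cl_ivl_Suc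
      by (simp add: mult_ac del: of_real_add)
  qed
  finally show ?case .
qed

section \<open>Branches of the power on the positive half-line\<close>

text \<open>
  The quotient of the branch and the positive power is continuous with values in the countable set of
  all \<open>exp (2 pi \<nu> k \<i>)\<close>, hence constant on the connected half-line.
\<close>
lemma power_branch_on_positive_reals:
  assumes p: "power_branch \<nu> D p" and D: "\<And>x. x > 0 \<Longrightarrow> complex_of_real x \<in> D"
  obtains \<kappa> where "\<kappa> \<noteq> 0" "\<And>x. x > 0 \<Longrightarrow> p (of_real x) = \<kappa> * of_real (x powr \<nu>)"
proof -
  define q where "q x = p (of_real x) / of_real (x powr \<nu>)" for x :: real
  have hol: "p holomorphic_on D" and val: "\<And>z. z \<in> D \<Longrightarrow> \<exists>w. exp w = z \<and> p z = exp (of_real \<nu> * w)"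
    using p unfolding power_branch_def by auto
  have vals: "\<exists>k::int. q x = exp (of_real (2 * pi * \<nu> * of_int k) * \<i>)" if x: "x > 0" for x
  proof -
    obtain w where w: "exp w = of_real x" "p (of_real x) = exp (of_real \<nu> * w)"
      using val[OF D[OF x]] by blast
    have "exp w = exp (of_real (ln x))" using w(1) that by (simp add: exp_of_real)
    then obtain k :: int where k: "w = of_real (ln x) + (of_int (2 * k) * pi) * \<i>"
      unfolding exp_eq by blast
    have "of_real \<nu> * w = of_real (\<nu> * ln x) + of_real (2 * pi * \<nu> * of_int k) * \<i>"
      unfolding k by (simp add: algebra_simps)
    then have "p (of_real x) = exp (of_real (\<nu> * ln x)) * exp (of_real (2 * pi * \<nu> * of_int k) * \<i>)"
      unfolding w(2) by (simp only: exp_add)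
    moreover have "exp (of_real (\<nu> * ln x)) = complex_of_real (x powr \<nu>)"
      using that by (simp add: powr_def del: of_real_mult flip: exp_of_real)
    ultimately show ?thesis using that by (intro exI[of _ k]) (simp add: q_def)
  qed
  have cont: "continuous_on {0<..} q"
  proof -
    have "continuous_on {0<..} (\<lambda>x::real. p (of_real x))"
      by (rule continuous_on_compose2[OF holomorphic_on_imp_continuous_on[OF hol]])
         (use D in \<open>auto intro!: continuous_intros\<close>)
    then show ?thesis unfolding q_def by (intro continuous_intros) auto
  qed
  have "countable (q ` {0<..})"
  proof (rule countable_subset)
    show "q ` {0<..} \<subseteq> range (\<lambda>k::int. exp (of_real (2 * pi * \<nu> * of_int k) * \<i>))"
      using vals by auto
  qed simp
  moreover have "connected (q ` {0<..})" using cont by (intro connected_continuous_image) auto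
  ultimately have "\<exists>a. q ` {0<..} \<subseteq> {a}" using connected_card_eq_iff_nontrivial by blast
  then obtain a where a: "\<And>x. x > 0 \<Longrightarrow> q x = a" by blast
  have "a \<noteq> 0" using vals[of 1] a[of 1] by auto
  moreover have "p (of_real x) = a * of_real (x powr \<nu>)" if "x > 0" for x
    using a[OF that] that by (simp add: q_def field_simps)
  ultimately show thesis using that by blast
qed

section \<open>Functions orthogonal with respect to their own zeros\<close>

theorem theorem4:
  fixes \<nu> \<alpha> \<beta> \<mu> :: real
    and D :: "complex set"
    and p F f :: "complex \<Rightarrow> complex"
    and l :: "nat \<Rightarrow> real"
    and a :: complex
  assumes "\<alpha> > -1 - 2 * \<nu>" and "\<beta> > -1"
    and "class_A \<nu> \<alpha> D p F l f"
    and "\<And>n m. n \<noteq> m \<Longrightarrow>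
      (LBINT t:{0<..<1}. f (of_real (l n * t)) * f (of_real (l m * t)) *
         of_real (t powr \<alpha> * (1 - t) powr \<beta>)) = 0"
    and "a = deriv (deriv F) 0"
    and "\<mu> = 2 * \<nu> + \<alpha> + 1"
  shows "\<exists>C. \<forall>z\<in>D. summable (\<lambda>n. even_coeff a \<beta> \<mu> n * z ^ (2 * n)) \<and>
    f z = C * p z * (\<Sum>n. even_coeff a \<beta> \<mu> n * z ^ (2 * n))"
proof -
  have branch: "power_branch \<nu> D p" and D: "\<And>x. x > 0 \<Longrightarrow> complex_of_real x \<in> D"
    and f_eq: "\<And>z. z \<in> D \<Longrightarrow> f z = p z * F z"
    and F: "F holomorphic_on UNIV" "\<And>z. F (- z) = F z" "F 0 = 1"
    and order: "growth_order F < 2 \<or> growth_order F = 2 \<and> growth_type 2 F = 0"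
    and l_pos: "\<And>n. l n > 0"
    and F_zero: "\<And>z. F z = 0 \<longleftrightarrow> (\<exists>n. z = of_real (l n) \<or> z = - of_real (l n))"
    and F_zorder: "\<And>n. zorder F (of_real (l n)) = int (card {k. l k = l n})"
    and summ: "summable (\<lambda>n. 1 / (l n)\<^sup>2)"
    using assms(3) unfolding class_A_def by auto
  have "\<mu> > 0" using assms(1,6) by simp
  obtain \<Phi> where \<Phi>: "\<Phi> holomorphic_on UNIV" and F\<Phi>: "\<And>z. F z = \<Phi> (z\<^sup>2)"
    using even_entire_obtains[OF F(1,2)] by blast
  have F_def: "F = (\<lambda>z. \<Phi> (z\<^sup>2))" using F\<Phi> by auto
  have \<Phi>0: "\<Phi> 0 = 1" using F(3) F\<Phi>[of 0] by simp
  define s where "s n = (l n)\<^sup>2" for n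
  define M where "M = beta_measure \<mu> (\<beta> + 1)"
  interpret positive_zeros \<Phi> s
  proof
    show "minimal_type \<Phi>" by (rule minimal_type_of_order_2[OF F(1,3) order F\<Phi>])
    show "s k > 0" for k using l_pos[of k] by (simp add: s_def)
    show "\<Phi> w = 0 \<longleftrightarrow> (\<exists>k. w = of_real (s k))" for w
    proof -
      have "\<Phi> w = 0 \<longleftrightarrow> F (csqrt w) = 0" by (simp add: F\<Phi>)
      also have "\<dots> \<longleftrightarrow> (\<exists>k. (csqrt w)\<^sup>2 = (of_real (l k))\<^sup>2)"
        unfolding F_zero power2_eq_iff ..
      finally show ?thesis by (simp add: s_def)
    qed
    show "zorder \<Phi> (of_real (s k)) = int (card {j. s j = s k})" for k
    proof -
      have "{j. s j = s k} = {j. l j = l k}"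
        using l_pos by (auto simp: s_def power2_eq_iff_nonneg less_imp_le)
      moreover have "zorder F (of_real (l k)) = zorder \<Phi> ((of_real (l k))\<^sup>2)"
        unfolding F_def using \<Phi> \<Phi>0 l_pos[of k] by (intro zorder_square_argument) auto
      ultimately show ?thesis using F_zorder[of k] by (simp add: s_def)
    qed
    show "summable (\<lambda>k. 1 / s k)" using summ by (simp add: s_def)
  qed (use \<Phi> \<Phi>0 in auto)
  interpret unit_interval_measure M unfolding M_def by (rule unit_interval_beta_measure)
  interpret finite_measure M unfolding M_def using \<open>\<mu> > 0\<close> assms(2) by (intro finite_beta_measure) auto
  obtain \<kappa> where \<kappa>: "\<kappa> \<noteq> 0" "\<And>x. x > 0 \<Longrightarrow> p (of_real x) = \<kappa> * of_real (x powr \<nu>)"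
    using power_branch_on_positive_reals[OF branch D] by blast
  interpret orthogonal_zeros \<Phi> s M
  proof
    show "emeasure M {x} = 0" for x unfolding M_def by (rule beta_measure_no_atoms)
    show "emeasure M (space M) \<noteq> 0" unfolding M_def
      using \<open>\<mu> > 0\<close> assms(2) by (intro beta_measure_nonnull) auto
    fix n m :: nat assume "n \<noteq> m"
    define G where "G t = \<Phi> (of_real (t\<^sup>2) * of_real (s n)) * \<Phi> (of_real (t\<^sup>2) * of_real (s m))" for t
    \<comment> \<open>The product of the branch values at \<open>l n * t\<close> and \<open>l m * t\<close>, without the power of \<open>t\<close> that
      becomes part of the measure.\<close>
    define K where "K = \<kappa>\<^sup>2 * of_real ((l n * l m) powr \<nu>)"
    have "K \<noteq> 0" using \<kappa>(1) l_pos[of n] l_pos[of m] by (simp add: K_def)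
    have "continuous_on UNIV G" unfolding G_def
      by (intro continuous_intros continuous_on_compose2[OF holomorphic_on_imp_continuous_on[OF \<Phi>]]) auto
    then have [measurable]: "G \<in> borel_measurable borel" by (rule borel_measurable_continuous_onI)
    have "f (of_real (l n * t)) * f (of_real (l m * t)) * of_real (t powr \<alpha> * (1 - t) powr \<beta>) =
        K * ((t powr (\<mu> - 1) * (1 - t) powr (\<beta> + 1 - 1)) *\<^sub>R G t)" if "0 < t" for t
    proof -
      have f: "f (of_real (l k * t)) = \<kappa> * of_real (l k powr \<nu>) * of_real (t powr \<nu>) * \<Phi> (of_real (t\<^sup>2) * of_real (s k))" for k
      proof -
        have pos: "l k * t > 0" using l_pos[of k] that by simp
        show ?thesis unfolding f_eq[OF D[OF pos]] \<kappa>(2)[OF pos] F\<Phi>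
          using l_pos[of k] that by (simp add: powr_mult s_def power_mult_distrib mult_ac)
      qed
      have "t powr \<nu> * t powr \<nu> * t powr \<alpha> = t powr (\<mu> - 1)"
        unfolding assms(6) by (simp flip: powr_add)
      then have "complex_of_real (t powr (\<mu> - 1)) = of_real (t powr \<nu>) * of_real (t powr \<nu>) * of_real (t powr \<alpha>)"
        by (simp flip: of_real_mult)
      then show ?thesis unfolding f using l_pos[of n] l_pos[of m]
        by (simp add: K_def G_def scaleR_conv_of_real powr_mult power2_eq_square mult_ac)
    qed
    then have "(LBINT t:{0<..<1}. f (of_real (l n * t)) * f (of_real (l m * t)) * of_real (t powr \<alpha> * (1 - t) powr \<beta>)) =
        (LBINT t:{0<..<1}. K * ((t powr (\<mu> - 1) * (1 - t) powr (\<beta> + 1 - 1)) *\<^sub>R G t))"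
      by (intro set_lebesgue_integral_cong) auto
    also have "\<dots> = K * (\<integral>t. G t \<partial>M)"
      unfolding M_def by (subst integral_beta_measure) (simp_all only: set_integral_mult_right \<open>G \<in> borel_measurable borel\<close>)
    finally show "(\<integral>t. \<Phi> (of_real (t\<^sup>2) * of_real (s n)) * \<Phi> (of_real (t\<^sup>2) * of_real (s m)) \<partial>M) = 0"
      using assms(4)[OF \<open>n \<noteq> m\<close>] \<open>K \<noteq> 0\<close> by (simp add: G_def)
  qed
  have c_eq: "taylor k = even_coeff a \<beta> \<mu> k" for k
  proof (rule even_coeff_unique[OF \<open>\<mu> > 0\<close> assms(2) taylor_0 _ _ coeff_recurrence])
    show "taylor 1 = a / 2"
      unfolding assms(5) F_def deriv_deriv_square_argument[OF \<Phi>] by (simp add: taylor_def)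
    show "(\<integral>t. t ^ (2 * k) \<partial>M) = Beta (\<mu> + 2 * real k) (\<beta> + 1)" for k
      unfolding M_def using \<open>\<mu> > 0\<close> assms(2) by (subst beta_measure_moment) auto
  qed
  have "(\<lambda>n. even_coeff a \<beta> \<mu> n * z ^ (2 * n)) sums F z" for z
    using taylor_sums[of "z\<^sup>2"] by (simp add: c_eq F\<Phi> power_mult)
  then show ?thesis using f_eq
    by (intro exI[of _ 1]) (auto simp: sums_iff)
qed

end
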